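(* For any $t_1>0$, $$\sup_{t\ge t_1}\ \sup_{x\in\mathbb R^d_\varepsilon}\left|\mathbf u^\varepsilon(x,t)-\frac{1}{t^{d/\ell}}H\!\left(\frac{x}{t^{1/\ell}}\right)\right|=O(\varepsilon^M)\quad\text{as }\varepsilon\to0.$$
   Context: Differential operator. Let $d\in\mathbb N$ and let $\ell\in\mathbb N$ be even. Let $\mathcal A(\mathcal D)=\sum_{|\alpha|=\ell}b_\alpha\mathcal D^\alpha$ with $b_\alpha\in\mathbb C$, $\mathcal D_j=-i\,\partial/\partial y_j$, be a differential operator on $\mathbb R^d$ with symbol $\mathcal A(\xi)=\sum_{|\alpha|=\ell}b_\alpha\xi^\alpha$. It is strongly elliptic: there is $c>0$ with $\operatorname{Re}\mathcal A(\xi)\ge c|\xi|^\ell$ for all $\xi\in\mathbb R^d$. Put $H(y)=\frac{1}{(2\pi)^d}\int_{\mathbb R^d}e^{-\mathcal A(\xi)}e^{iy\xi}\,d\xi$. Difference operator. For $\varepsilon>0$ let $\mathbb R^d_\varepsilon=\varepsilon\mathbb Z^d$. For a function $u$ on $\mathbb R^d$ or on $\mathbb R^d_\varepsilon$ let $\delta_{\varepsilon,k\pm}u(y)=u(y\pm\varepsilon e_k)-u(y)$, where $e_k$ is the $k$th unit coordinate vector. Fix an integer $\hat\ell\ge\ell$ and coefficients $a_\nu\in\mathbb C$ (not depending on $\varepsilon$), $\nu=(\nu_1,\dots,\nu_{2d})$ a multi-index, and let $$\mathbf A_\varepsilon=\varepsilon^{-\ell}\sum_{\ell\le|\nu|\le\hat\ell}a_\nu\,\delta_{\varepsilon,1-}^{\nu_1}\delta_{\varepsilon,1+}^{\nu_2}\cdots\delta_{\varepsilon,d-}^{\nu_{2d-1}}\delta_{\varepsilon,d+}^{\nu_{2d}}.$$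 A function on $\mathbb R^d$ is called smooth if it is continuous and bounded together with all its derivatives. Assume that $\mathbf A_\varepsilon$ is an $M$th order approximation of $\mathcal A(\mathcal D)$ for a fixed $M\in\mathbb N$: for every smooth $u$ there is $C(u)>0$ such that $\sup_{y\in\mathbb R^d}|\mathbf A_\varepsilon u(y)-\mathcal A(\mathcal D)u(y)|\le C(u)\varepsilon^M$ for all $\varepsilon>0$. The symbol of $\mathbf A_\varepsilon$ is $$A(\theta)=\sum_{\ell\le|\nu|\le\hat\ell}a_\nu(e^{-i\theta_1}-1)^{\nu_1}(e^{i\theta_1}-1)^{\nu_2}\cdots(e^{-i\theta_d}-1)^{\nu_{2d-1}}(e^{i\theta_d}-1)^{\nu_{2d}}.$$ Assume $\operatorname{Re}A(\theta)>0$ for all $\theta\in R_\pi\setminus\{0\}$, where $R_\lambda=[-\lambda,\lambda]^d$. First discrete Green function. $\mathbf u^\varepsilon(x,t)$, $x\in\mathbb R^d_\varepsilon$, $t\ge0$, is the function that is rapidly decreasing in $x$ (faster than any negative power of $|x|$), $C^1$ in $t\in[0,\infty)$, and satisfies $\partial_t\mathbf u^\varepsilon+\mathbf A_\varepsilon\mathbf u^\varepsilon=0$ for $t>0$, with $\mathbf u^\varepsilon(0,0)=\varepsilon^{-d}$ and $\mathbf u^\varepsilon(x,0)=0$ for $x\ne0$. It is given by $\mathbf u^\varepsilon(x,t)=\frac1{(2\pi)^d}\int_{R_{\pi/\varepsilon}}e^{-t\varepsilon^{-\ell}A(\varepsilon\eta)}e^{ix\eta}\,d\eta$. *)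

theory Defs
  imports "HOL-Analysis.Analysis"
begin

text \<open>
  The coordinates of \<open>\<real>\<^sup>d\<close> are indexed by a finite type of cardinality \<open>d\<close>; its linear order is
  used only to fix the order in which operators acting on different coordinates are composed.
\<close>

definition coord_comp :: "('n::{finite,linorder} \<Rightarrow> 'f \<Rightarrow> 'f) \<Rightarrow> 'f \<Rightarrow> 'f" where
  "coord_comp T = foldr T (sorted_list_of_set UNIV)"

definition multi_idx :: "nat \<Rightarrow> ('n::finite \<Rightarrow> nat) set" where
  "multi_idx l = {\<alpha>. (\<Sum>k\<in>UNIV. \<alpha> k) = l}"

text \<open>
  A multi-index with \<open>2d\<close> entries is split into a pair \<open>(\<mu>, \<nu>)\<close>: \<open>\<mu>\<close> holds the exponents of the
  backward differences (odd positions), \<open>\<nu>\<close> those of the forward differences (even positions).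
\<close>

definition diff_idx :: "nat \<Rightarrow> nat \<Rightarrow> (('n::finite \<Rightarrow> nat) \<times> ('n \<Rightarrow> nat)) set" where
  "diff_idx l l' = {(\<mu>, \<nu>). l \<le> (\<Sum>k\<in>UNIV. \<mu> k) + (\<Sum>k\<in>UNIV. \<nu> k) \<and>
                           (\<Sum>k\<in>UNIV. \<mu> k) + (\<Sum>k\<in>UNIV. \<nu> k) \<le> l'}"

lemma finite_sum_le: "finite {\<alpha> :: 'n::finite \<Rightarrow> nat. (\<Sum>k\<in>UNIV. \<alpha> k) \<le> l}"
proof (rule finite_subset)
  have "\<alpha> k \<le> l" if "(\<Sum>k\<in>UNIV. \<alpha> k) \<le> l" for \<alpha> :: "'n \<Rightarrow> nat" and k
    using member_le_sum[of k UNIV \<alpha>] that by simp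
  then show "{\<alpha> :: 'n \<Rightarrow> nat. (\<Sum>k\<in>UNIV. \<alpha> k) \<le> l} \<subseteq> PiE UNIV (\<lambda>_. {..l})"
    by auto
qed (auto intro: finite_PiE)

lemma finite_multi_idx: "finite (multi_idx l)"
  unfolding multi_idx_def by (rule finite_subset[OF _ finite_sum_le[of l]]) auto

lemma finite_diff_idx: "finite (diff_idx l l')"
  by (rule finite_subset[OF _ finite_cartesian_product[OF finite_sum_le[of l'] finite_sum_le[of l']]])
     (auto simp: diff_idx_def)

definition partial_deriv :: "'n \<Rightarrow> (real^'n::finite \<Rightarrow> complex) \<Rightarrow> real^'n::finite \<Rightarrow> complex" where
  "partial_deriv k u y = vector_derivative (\<lambda>s. u (y + s *\<^sub>R axis k 1)) (at 0)"

text \<open>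
  Existence of the partial derivatives is demanded separately, because \<open>vector_derivative\<close> is total.
\<close>

definition smooth_bounded :: "(real^'n::finite \<Rightarrow> complex) \<Rightarrow> bool" where
  "smooth_bounded u \<longleftrightarrow>
     (\<forall>ks. let v = foldr partial_deriv ks u in
        continuous_on UNIV v \<and> bounded (range v) \<and>
        (\<forall>k y. (\<lambda>s. v (y + s *\<^sub>R axis k 1)) differentiable (at 0)))"

definition diff_op ::
  "nat \<Rightarrow> (('n \<Rightarrow> nat) \<Rightarrow> complex) \<Rightarrow> (real^'n::{finite,linorder} \<Rightarrow> complex) \<Rightarrow> real^'n::{finite,linorder} \<Rightarrow> complex" where
  "diff_op l b u y =
     (\<Sum>\<alpha>\<in>multi_idx l. b \<alpha> * coord_comp (\<lambda>k. (\<lambda>v z. - \<i> * partial_deriv k v z) ^^ \<alpha> k) u y)"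

definition diff_symbol :: "nat \<Rightarrow> (('n \<Rightarrow> nat) \<Rightarrow> complex) \<Rightarrow> real^'n::finite \<Rightarrow> complex" where
  "diff_symbol l b \<xi> = (\<Sum>\<alpha>\<in>multi_idx l. b \<alpha> * (\<Prod>k\<in>UNIV. complex_of_real (\<xi> $ k) ^ \<alpha> k))"

definition strongly_elliptic :: "nat \<Rightarrow> (('n::finite \<Rightarrow> nat) \<Rightarrow> complex) \<Rightarrow> bool" where
  "strongly_elliptic l b \<longleftrightarrow> (\<exists>c>0. \<forall>\<xi>. Re (diff_symbol l b \<xi>) \<ge> c * norm \<xi> ^ l)"

definition H_kernel :: "nat \<Rightarrow> (('n \<Rightarrow> nat) \<Rightarrow> complex) \<Rightarrow> real^'n::finite \<Rightarrow> complex" where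
  "H_kernel l b y = complex_of_real (1 / (2 * pi) ^ CARD('n)) *
     (LINT \<xi>|lborel. exp (- diff_symbol l b \<xi>) * exp (\<i> * complex_of_real (y \<bullet> \<xi>)))"

definition grid :: "real \<Rightarrow> (real^'n::finite) set" where
  "grid \<epsilon> = {x. \<forall>k. x $ k / \<epsilon> \<in> \<int>}"

text \<open>
  \<open>fdiff \<epsilon> k\<close> is the forward difference and \<open>fdiff (- \<epsilon>) k\<close> the backward difference.  A function on
  the grid is represented by any of its extensions to the whole space: at a grid point the
  difference operators only see the values at grid points.
\<close>

definition fdiff :: "real \<Rightarrow> 'n \<Rightarrow> (real^'n::finite \<Rightarrow> complex) \<Rightarrow> real^'n::finite \<Rightarrow> complex" where
  "fdiff h k u y = u (y + h *\<^sub>R axis k 1) - u y"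

definition difference_op ::
  "nat \<Rightarrow> nat \<Rightarrow> (('n \<Rightarrow> nat) \<times> ('n \<Rightarrow> nat) \<Rightarrow> complex) \<Rightarrow> real \<Rightarrow>
     (real^'n::{finite,linorder} \<Rightarrow> complex) \<Rightarrow> real^'n::{finite,linorder} \<Rightarrow> complex" where
  "difference_op l l' a \<epsilon> u y = complex_of_real (1 / \<epsilon> ^ l) *
     (\<Sum>(\<mu>, \<nu>)\<in>diff_idx l l'. a (\<mu>, \<nu>) *
        coord_comp (\<lambda>k. (fdiff (- \<epsilon>) k ^^ \<mu> k) \<circ> (fdiff \<epsilon> k ^^ \<nu> k)) u y)"

definition difference_symbol ::
  "nat \<Rightarrow> nat \<Rightarrow> (('n \<Rightarrow> nat) \<times> ('n \<Rightarrow> nat) \<Rightarrow> complex) \<Rightarrow> real^'n::finite \<Rightarrow> complex" where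
  "difference_symbol l l' a \<theta> =
     (\<Sum>(\<mu>, \<nu>)\<in>diff_idx l l'. a (\<mu>, \<nu>) *
        (\<Prod>k\<in>UNIV. (exp (- \<i> * complex_of_real (\<theta> $ k)) - 1) ^ \<mu> k *
                   (exp (\<i> * complex_of_real (\<theta> $ k)) - 1) ^ \<nu> k))"

definition approximates_of_order ::
  "nat \<Rightarrow> nat \<Rightarrow> nat \<Rightarrow> (('n::{finite,linorder} \<Rightarrow> nat) \<times> ('n \<Rightarrow> nat) \<Rightarrow> complex) \<Rightarrow>
     (('n \<Rightarrow> nat) \<Rightarrow> complex) \<Rightarrow> bool" where
  "approximates_of_order M l l' a b \<longleftrightarrow>
     (\<forall>u. smooth_bounded u \<longrightarrow>
        (\<exists>C>0. \<forall>\<epsilon>>0.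
           (SUP y. ereal (norm (difference_op l l' a \<epsilon> u y - diff_op l b u y))) \<le> ereal (C * \<epsilon> ^ M)))"

text \<open>
  Only the values \<open>u x t\<close> with \<open>x \<in> grid \<epsilon>\<close> and \<open>t \<ge> 0\<close> matter.  Rapid decrease is required for
  each \<open>t\<close> separately, with no uniformity in \<open>t\<close>.
\<close>

definition first_green_function ::
  "nat \<Rightarrow> nat \<Rightarrow> (('n \<Rightarrow> nat) \<times> ('n \<Rightarrow> nat) \<Rightarrow> complex) \<Rightarrow> real \<Rightarrow>
     (real^'n::{finite,linorder} \<Rightarrow> real \<Rightarrow> complex) \<Rightarrow> bool" where
  "first_green_function l l' a \<epsilon> u \<longleftrightarrow>
     (\<forall>t\<ge>0. \<forall>N::nat. \<exists>C. \<forall>x\<in>grid \<epsilon>. norm x ^ N * norm (u x t) \<le> C) \<and>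
     (\<forall>x\<in>grid \<epsilon>.
        (\<forall>t\<ge>0. u x differentiable (at t within {0..})) \<and>
        continuous_on {0..} (\<lambda>t. vector_derivative (u x) (at t within {0..})) \<and>
        (\<forall>t>0. vector_derivative (u x) (at t) + difference_op l l' a \<epsilon> (\<lambda>z. u z t) x = 0) \<and>
        u x 0 = (if x = 0 then complex_of_real (1 / \<epsilon> ^ CARD('n)) else 0))"

end

theory Submission imports Defs begin

text \<open>
  Applying the approximation property to plane waves shows that \<open>\<A>(\<theta>)\<close> and \<open>A(\<theta>)\<close> differ by
  \<open>O(|\<theta>|\<^sup>l\<^sup>+\<^sup>M)\<close>; together with ellipticity and the positivity of \<open>Re A\<close> this makes \<open>Re A(\<theta>)\<close> at
  least a multiple of \<open>|\<theta>|\<^sup>l\<close> on \<open>[-\<pi>, \<pi>]\<^sup>d\<close>.  Both kernels are Fourier integrals, and after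
  rescaling \<open>H\<close> the difference of the integrands is bounded, uniformly for \<open>t \<ge> t\<^sub>1\<close>, by a multiple of
  \<open>\<epsilon>\<^sup>M |\<eta>|\<^sup>M exp(- c |\<eta>|\<^sup>l)\<close>: inside the cell \<open>[-\<pi>/\<epsilon>, \<pi>/\<epsilon>]\<^sup>d\<close> one factor \<open>t |\<eta>|\<^sup>l\<close> is absorbed by the
  exponential, and outside of it \<open>\<epsilon> |\<eta>| \<ge> \<pi>\<close>.  The integral representation of the discrete Green
  function rests on uniqueness for the difference equation.
\<close>

section \<open>Difference and differential operators on plane waves\<close>

text \<open>The constant in the approximation hypothesis depends on the test function, so a plane
  wave only gives a constant depending on its frequency, while the comparison of the kernels
  integrates over all frequencies. One constant for all of them is available because
  \<open>difference_symbol\<close> is a finite sum of exponentials, which is controlled by its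
  Taylor expansion along rays. In the comparison, the factor t |\<eta>|^l produced by the mean value
  inequality costs one half of the decay rate; the other half has to remain integrable uniformly in
  t, which is where a positive \<open>t1\<close> enters. A plain Gronwall estimate does not give
  uniqueness: the decay of the Green function in space is prescribed at each time separately, so its
  supremum over the grid might be unbounded near some time.\<close>

definition wave :: "real^'n::finite \<Rightarrow> real^'n \<Rightarrow> complex" where
  "wave \<eta> y = exp (\<i> * complex_of_real (y \<bullet> \<eta>))"

lemma norm_wave [simp]: "norm (wave \<eta> y) = 1"
  by (simp add: wave_def)

lemma wave_zero_right [simp]: "wave \<eta> 0 = 1"
  by (simp add: wave_def)

lemma wave_add: "wave \<eta> (y + z) = wave \<eta> y * wave \<eta> z"
  by (simp add: wave_def inner_add_left exp_add algebra_simps)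

lemma wave_axis: "wave \<eta> (h *\<^sub>R axis k 1) = exp (\<i> * complex_of_real (h * \<eta> $ k))"
  by (simp add: wave_def inner_axis')

lemma continuous_on_wave [continuous_intros]:
  "continuous_on S f \<Longrightarrow> continuous_on S g \<Longrightarrow> continuous_on S (\<lambda>x. wave (f x) (g x))"
  unfolding wave_def by (intro continuous_intros)

text \<open>Multiples of \<open>w\<close> are built in so that composites need no linearity: the
  inner operator hands a multiple of \<open>w\<close> to the outer one. This matters for
  \<open>partial_deriv\<close>, whose linearity is guaranteed only on differentiable
  functions.\<close>

definition eigenfunction :: "(('a \<Rightarrow> complex) \<Rightarrow> 'a \<Rightarrow> complex) \<Rightarrow> ('a \<Rightarrow> complex) \<Rightarrow> complex \<Rightarrow> bool" where
  "eigenfunction T w c \<longleftrightarrow> (\<forall>r. T (\<lambda>z. r * w z) = (\<lambda>z. r * c * w z))"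

lemma eigenfunctionD: "eigenfunction T w c \<Longrightarrow> T w = (\<lambda>z. c * w z)"
  unfolding eigenfunction_def by (drule spec[of _ 1]) simp

lemma eigenfunction_comp:
  assumes "eigenfunction S w c" "eigenfunction T w d"
  shows "eigenfunction (S \<circ> T) w (c * d)"
  unfolding eigenfunction_def
proof
  fix r
  have "(S \<circ> T) (\<lambda>z. r * w z) = S (\<lambda>z. (r * d) * w z)"
    using assms(2) by (simp add: eigenfunction_def)
  also have "\<dots> = (\<lambda>z. (r * d) * c * w z)"
    using assms(1) unfolding eigenfunction_def by blast
  finally show "(S \<circ> T) (\<lambda>z. r * w z) = (\<lambda>z. r * (c * d) * w z)"
    by (simp add: mult_ac)
qed

lemma eigenfunction_funpow: "eigenfunction T w c \<Longrightarrow> eigenfunction (T ^^ n) w (c ^ n)"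
proof (induction n)
  case 0
  then show ?case by (simp add: eigenfunction_def)
next
  case (Suc n)
  then show ?case using eigenfunction_comp[of T w c "T ^^ n" "c ^ n"] by (simp add: o_def)
qed

lemma eigenfunction_coord_comp:
  assumes "\<And>k. eigenfunction (T k) w (c k)"
  shows "eigenfunction (coord_comp T) w (\<Prod>k\<in>UNIV. c k)"
proof -
  have "eigenfunction (foldr T ks) w (\<Prod>k\<in>set ks. c k)" if "distinct ks" for ks
    using that
  proof (induction ks)
    case Nil
    then show ?case by (simp add: eigenfunction_def)
  next
    case (Cons k ks)
    then show ?case using eigenfunction_comp[OF assms[of k], of "foldr T ks"] by (simp add: o_def)
  qed
  from this[of "sorted_list_of_set UNIV"] show ?thesis
    by (simp add: coord_comp_def)
qed

lemma eigenfunction_fdiff: "eigenfunction (fdiff h k) (wave \<eta>) (exp (\<i> * complex_of_real (h * \<eta> $ k)) - 1)"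
  by (auto simp: eigenfunction_def fdiff_def wave_add wave_axis algebra_simps)

lemma wave_has_vector_derivative:
  "((\<lambda>s. r * wave \<eta> (y + s *\<^sub>R axis k 1)) has_vector_derivative (r * (\<i> * \<eta> $ k) * wave \<eta> y)) (at 0)"
  unfolding wave_add wave_axis
  by (auto intro!: derivative_eq_intros has_vector_derivative_real_field simp: mult_ac)

lemma partial_deriv_wave:
  "partial_deriv k (\<lambda>z. r * wave \<eta> z) = (\<lambda>z. r * (\<i> * \<eta> $ k) * wave \<eta> z)"
  unfolding partial_deriv_def using wave_has_vector_derivative vector_derivative_at by blast

lemma eigenfunction_partial_deriv:
  "eigenfunction (\<lambda>v z. - \<i> * partial_deriv k v z) (wave \<eta>) (\<eta> $ k)"
  by (simp add: eigenfunction_def partial_deriv_wave fun_eq_iff algebra_simps)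

lemma difference_op_wave:
  fixes a :: "('n::{finite,linorder} \<Rightarrow> nat) \<times> ('n \<Rightarrow> nat) \<Rightarrow> complex"
  shows "difference_op l l' a \<epsilon> (wave \<eta>) y =
    complex_of_real (1 / \<epsilon> ^ l) * difference_symbol l l' a (\<epsilon> *\<^sub>R \<eta>) * wave \<eta> y"
proof -
  have "eigenfunction (coord_comp (\<lambda>k. (fdiff (- \<epsilon>) k ^^ \<mu> k) \<circ> (fdiff \<epsilon> k ^^ \<nu> k))) (wave \<eta>)
     (\<Prod>k\<in>UNIV. (exp (\<i> * complex_of_real (- \<epsilon> * \<eta> $ k)) - 1) ^ \<mu> k *
                (exp (\<i> * complex_of_real (\<epsilon> * \<eta> $ k)) - 1) ^ \<nu> k)" for \<mu> \<nu> :: "'n \<Rightarrow> nat"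
    by (intro eigenfunction_coord_comp eigenfunction_comp eigenfunction_funpow eigenfunction_fdiff)
  note eigenfunctionD[OF this]
  then show ?thesis
    by (simp add: difference_op_def difference_symbol_def sum_distrib_right sum_distrib_left case_prod_unfold mult_ac)
qed

lemma diff_op_wave: "diff_op l b (wave \<eta>) y = diff_symbol l b \<eta> * wave \<eta> y"
proof -
  have "eigenfunction (coord_comp (\<lambda>k. (\<lambda>v z. - \<i> * partial_deriv k v z) ^^ \<alpha> k)) (wave \<eta>)
     (\<Prod>k\<in>UNIV. complex_of_real (\<eta> $ k) ^ \<alpha> k)" for \<alpha>
    by (intro eigenfunction_coord_comp eigenfunction_funpow eigenfunction_partial_deriv)
  note eigenfunctionD[OF this]
  then show ?thesis
    by (simp add: diff_op_def diff_symbol_def sum_distrib_right mult.assoc)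
qed

text \<open>Every iterated partial derivative is a scalar multiple of the same wave, so the
  regularity conditions need checking for such a multiple only.\<close>

lemma smooth_bounded_wave: "smooth_bounded (wave \<eta>)"
proof -
  have ex: "\<exists>r. foldr partial_deriv ks (wave \<eta>) = (\<lambda>z. r * wave \<eta> z)" for ks
  proof (induction ks)
    case Nil
    show ?case by (auto intro: exI[of _ 1])
  next
    case (Cons k ks)
    then show ?case by (auto simp: partial_deriv_wave)
  qed
  have "continuous_on UNIV v \<and> bounded (range v) \<and>
        (\<forall>k y. (\<lambda>s. v (y + s *\<^sub>R axis k 1)) differentiable (at 0))"
    if v: "v = (\<lambda>z. r * wave \<eta> z)" for v r
    unfolding v
    using differentiableI_vector[OF wave_has_vector_derivative]
    by (auto intro!: continuous_intros boundedI[where B = "norm r"] simp: norm_mult)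
  then show ?thesis
    unfolding smooth_bounded_def Let_def using ex by meson
qed

section \<open>Difference operators as finite combinations of grid translations\<close>

lemma grid_add: "x \<in> grid \<epsilon> \<Longrightarrow> y \<in> grid \<epsilon> \<Longrightarrow> x + y \<in> grid \<epsilon>"
  by (simp add: grid_def add_divide_distrib)

lemma zero_in_grid: "0 \<in> grid \<epsilon>"
  by (simp add: grid_def)

text \<open>Pairs of coefficient and shift are kept in a list, where shifts may recur, so that sums
  of operators become concatenations. The shifts lie in the grid, so at grid points only values on
  the grid enter.\<close>

definition translation_comb ::
    "real \<Rightarrow> ((real^'n::finite \<Rightarrow> complex) \<Rightarrow> real^'n \<Rightarrow> complex) \<Rightarrow> bool" where
  "translation_comb \<epsilon> T \<longleftrightarrow> (\<exists>ps. snd ` set ps \<subseteq> grid \<epsilon> \<and>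
     T = (\<lambda>u y. \<Sum>p\<leftarrow>ps. fst p * u (y + snd p)))"

lemma translation_comb_single:
  "h \<in> grid \<epsilon> \<Longrightarrow> translation_comb \<epsilon> (\<lambda>u y. c * u (y + h))"
  unfolding translation_comb_def by (rule exI[of _ "[(c, h)]"]) auto

lemma translation_comb_add:
  assumes "translation_comb \<epsilon> S" "translation_comb \<epsilon> T"
  shows "translation_comb \<epsilon> (\<lambda>u y. S u y + T u y)"
proof -
  from assms obtain ps qs where "snd ` set ps \<subseteq> grid \<epsilon>" "snd ` set qs \<subseteq> grid \<epsilon>"
    "S = (\<lambda>u y. \<Sum>p\<leftarrow>ps. fst p * u (y + snd p))" "T = (\<lambda>u y. \<Sum>p\<leftarrow>qs. fst p * u (y + snd p))"
    unfolding translation_comb_def by blast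
  then show ?thesis
    unfolding translation_comb_def by (intro exI[of _ "ps @ qs"]) auto
qed

lemma translation_comb_cmult:
  assumes "translation_comb \<epsilon> T"
  shows "translation_comb \<epsilon> (\<lambda>u y. c * T u y)"
proof -
  from assms obtain qs where "snd ` set qs \<subseteq> grid \<epsilon>"
    "T = (\<lambda>u y. \<Sum>p\<leftarrow>qs. fst p * u (y + snd p))"
    unfolding translation_comb_def by blast
  then show ?thesis
    unfolding translation_comb_def
    by (intro exI[of _ "map (\<lambda>p. (c * fst p, snd p)) qs"])
       (auto simp: sum_list_const_mult o_def mult_ac)
qed

lemma translation_comb_zero: "translation_comb \<epsilon> (\<lambda>u y. 0)"
  unfolding translation_comb_def by (rule exI[of _ "[]"]) auto

lemma translation_comb_id: "translation_comb \<epsilon> (\<lambda>u. u)"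
  using translation_comb_single[OF zero_in_grid, of \<epsilon> 1] by simp

lemma translation_comb_sum:
  "finite I \<Longrightarrow> (\<And>i. i \<in> I \<Longrightarrow> translation_comb \<epsilon> (T i)) \<Longrightarrow>
    translation_comb \<epsilon> (\<lambda>u y. \<Sum>i\<in>I. T i u y)"
  by (induction I rule: finite_induct) (auto intro: translation_comb_zero translation_comb_add)

text \<open>Induction on the list of the outer operator; translating the result of the inner one
  adds the shifts, and the grid is closed under addition.\<close>

lemma translation_comb_comp:
  assumes "translation_comb \<epsilon> S" "translation_comb \<epsilon> T"
  shows "translation_comb \<epsilon> (S \<circ> T)"
proof -
  from assms obtain ps where ps: "snd ` set ps \<subseteq> grid \<epsilon>" "S = (\<lambda>u y. \<Sum>p\<leftarrow>ps. fst p * u (y + snd p))"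
    unfolding translation_comb_def by blast
  from assms obtain qs where qs: "snd ` set qs \<subseteq> grid \<epsilon>" "T = (\<lambda>u y. \<Sum>p\<leftarrow>qs. fst p * u (y + snd p))"
    unfolding translation_comb_def by blast
  have "translation_comb \<epsilon> (\<lambda>u y. \<Sum>p\<leftarrow>ps. fst p * T u (y + snd p))"
    using ps(1)
  proof (induction ps)
    case Nil
    show ?case by (simp add: translation_comb_zero)
  next
    case (Cons p ps)
    have "translation_comb \<epsilon> (\<lambda>u y. T u (y + snd p))"
      unfolding translation_comb_def using Cons.prems qs
      by (intro exI[of _ "map (\<lambda>q. (fst q, snd p + snd q)) qs"]) (auto simp: o_def add_ac intro!: grid_add)
    from translation_comb_add[OF translation_comb_cmult[OF this, of "fst p"] Cons.IH] Cons.prems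
    show ?case by simp
  qed
  then show ?thesis by (simp add: ps(2) o_def)
qed

lemma translation_comb_funpow: "translation_comb \<epsilon> T \<Longrightarrow> translation_comb \<epsilon> (T ^^ n)"
proof (induction n)
  case 0
  then show ?case using translation_comb_id by (simp add: id_def)
next
  case (Suc n)
  then show ?case using translation_comb_comp[of \<epsilon> T "T ^^ n"] by (simp add: o_def)
qed

lemma translation_comb_coord_comp:
  assumes "\<And>k. translation_comb \<epsilon> (T k)"
  shows "translation_comb \<epsilon> (coord_comp T)"
proof -
  have "translation_comb \<epsilon> (foldr T ks)" for ks
  proof (induction ks)
    case Nil
    show ?case using translation_comb_id by (simp add: id_def)
  next
    case (Cons k ks)
    then show ?case using translation_comb_comp[OF assms[of k], of "foldr T ks"] by (simp add: o_def)
  qed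
  then show ?thesis by (simp add: coord_comp_def)
qed

lemma translation_comb_fdiff:
  assumes "h / \<epsilon> \<in> \<int>"
  shows "translation_comb \<epsilon> (fdiff h k)"
proof -
  have "h *\<^sub>R axis k 1 \<in> grid \<epsilon>"
    using assms by (auto simp: grid_def axis_def)
  from translation_comb_add[OF translation_comb_single[OF this, of 1]
      translation_comb_single[OF zero_in_grid, of _ "-1"]]
  show ?thesis by (simp add: fdiff_def[abs_def])
qed

text \<open>This normal form bounds the operator in the supremum norm over the grid, lets it pass
  under an integral, and exhibits its symbol as a trigonometric polynomial.\<close>

lemma difference_op_translations:
  fixes a :: "('n::{finite,linorder} \<Rightarrow> nat) \<times> ('n \<Rightarrow> nat) \<Rightarrow> complex"
  assumes "\<epsilon> \<noteq> 0"
  obtains n :: nat and c p where "\<And>i. i < n \<Longrightarrow> p i \<in> grid \<epsilon>"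
    "\<And>u y. difference_op l l' a \<epsilon> u y = (\<Sum>i<n. c i * u (y + p i))"
proof -
  have "translation_comb \<epsilon> (\<lambda>u y. difference_op l l' a \<epsilon> u y)"
    unfolding difference_op_def case_prod_unfold using assms
    by (intro translation_comb_cmult translation_comb_sum finite_diff_idx translation_comb_coord_comp
        translation_comb_comp translation_comb_funpow translation_comb_fdiff) auto
  then obtain ps where ps: "snd ` set ps \<subseteq> grid \<epsilon>"
    "difference_op l l' a \<epsilon> = (\<lambda>u y. \<Sum>p\<leftarrow>ps. fst p * u (y + snd p))"
    unfolding translation_comb_def by blast
  show ?thesis
  proof
    show "difference_op l l' a \<epsilon> u y = (\<Sum>i<length ps. fst (ps ! i) * u (y + snd (ps ! i)))" for u y
      by (simp add: ps(2) sum_list_sum_nth atLeast0LessThan)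
    show "snd (ps ! i) \<in> grid \<epsilon>" if "i < length ps" for i
      using ps(1) that by auto
  qed
qed

section \<open>Comparison of the symbols\<close>

text \<open>Letting s tend to 0 kills the constant coefficient; after division by s the same
  hypothesis holds with N lowered by one.\<close>

lemma coeffs_zero_if_polynomial_small:
  fixes q :: "nat \<Rightarrow> complex"
  assumes "\<And>s. 0 < s \<Longrightarrow> norm (\<Sum>k<N. q k * complex_of_real s ^ k) \<le> C * s ^ N" and "k < N"
  shows "q k = 0"
  using assms
proof (induction N arbitrary: q k)
  case (Suc N)
  have "((\<lambda>s. norm (\<Sum>k<Suc N. q k * complex_of_real s ^ k)) \<longlongrightarrow>
      norm (\<Sum>k<Suc N. q k * complex_of_real 0 ^ k)) (at_right 0)"
    by (intro tendsto_intros)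
  moreover have "((\<lambda>s. C * s ^ Suc N) \<longlongrightarrow> C * 0 ^ Suc N) (at_right 0)"
    by (intro tendsto_intros)
  moreover have "\<forall>\<^sub>F s in at_right 0. norm (\<Sum>k<Suc N. q k * complex_of_real s ^ k) \<le> C * s ^ Suc N"
    using Suc.prems(1) by (auto simp: eventually_at_right_less eventually_at_filter)
  ultimately have "norm (\<Sum>k<Suc N. q k * complex_of_real 0 ^ k) \<le> C * 0 ^ Suc N"
    by (intro tendsto_le[OF trivial_limit_at_right_real])
  then have q0: "q 0 = 0"
    unfolding sum.lessThan_Suc_shift by simp
  have "norm (\<Sum>k<N. q (Suc k) * complex_of_real s ^ k) \<le> C * s ^ N" if "0 < s" for s
  proof -
    have "(\<Sum>k<Suc N. q k * complex_of_real s ^ k) = s * (\<Sum>k<N. q (Suc k) * complex_of_real s ^ k)"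
      unfolding sum.lessThan_Suc_shift by (simp add: q0 sum_distrib_left mult_ac)
    with Suc.prems(1)[OF that] have "s * norm (\<Sum>k<N. q (Suc k) * complex_of_real s ^ k) \<le> s * (C * s ^ N)"
      using that by (simp add: norm_mult mult_ac)
    with that show ?thesis by simp
  qed
  from Suc.IH[OF this] q0 show ?case
    using Suc.prems(2) by (cases k) auto
qed simp

lemma diff_symbol_scaleR: "diff_symbol l b (s *\<^sub>R \<eta>) = complex_of_real s ^ l * diff_symbol l b \<eta>"
proof -
  have "(\<Prod>k\<in>UNIV. complex_of_real ((s *\<^sub>R \<eta>) $ k) ^ \<alpha> k) =
      complex_of_real s ^ l * (\<Prod>k\<in>UNIV. complex_of_real (\<eta> $ k) ^ \<alpha> k)" if "\<alpha> \<in> multi_idx l" for \<alpha>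
    using that by (simp add: multi_idx_def power_mult_distrib prod.distrib power_sum[symmetric])
  then show ?thesis
    by (simp add: diff_symbol_def sum_distrib_left mult_ac)
qed

lemma continuous_on_diff_symbol [continuous_intros]:
  "continuous_on S f \<Longrightarrow> continuous_on S (\<lambda>x. diff_symbol l b (f x))"
  unfolding diff_symbol_def by (intro continuous_intros)

lemma continuous_on_difference_symbol [continuous_intros]:
  "continuous_on S f \<Longrightarrow> continuous_on S (\<lambda>x. difference_symbol l l' a (f x))"
  unfolding difference_symbol_def case_prod_unfold by (intro continuous_intros)

text \<open>The argument of the exponential is purely imaginary, so the Taylor remainder carries no
  exponential factor. Its bound is the same for all \<eta> in the unit ball, the source of
  uniformity in the direction.\<close>

lemma Taylor_wave:
  assumes "norm \<eta> \<le> 1" and "N > 0"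
  shows "norm (wave (s *\<^sub>R \<eta>) p - (\<Sum>k<N. (\<i> * (p \<bullet> \<eta>)) ^ k / fact k * complex_of_real s ^ k))
    \<le> norm p ^ N * \<bar>s\<bar> ^ N"
proof -
  define z where "z = \<i> * complex_of_real (s * (p \<bullet> \<eta>))"
  from \<open>N > 0\<close> obtain m where m: "N = Suc m" by (cases N) auto
  have "\<bar>p \<bullet> \<eta>\<bar> \<le> norm p * 1"
    using Cauchy_Schwarz_ineq2[of p \<eta>] assms(1) mult_left_mono[of "norm \<eta>" 1 "norm p"] by simp
  then have nz: "norm z \<le> norm p * \<bar>s\<bar>"
    by (simp add: z_def norm_mult abs_mult mult.commute[of "\<bar>s\<bar>"] mult_right_mono)
  have "norm (exp z - (\<Sum>k\<le>m. z ^ k / fact k)) \<le> norm z ^ Suc m / fact m"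
    using Taylor_exp[of z m] by (simp add: z_def)
  also have "\<dots> \<le> norm z ^ Suc m / 1"
    by (intro divide_left_mono) auto
  also have "\<dots> \<le> (norm p * \<bar>s\<bar>) ^ Suc m"
    using power_mono[OF nz, of "Suc m"] by simp
  finally show ?thesis
    by (simp add: wave_def z_def m lessThan_Suc_atMost power_mult_distrib mult_ac)
qed

text \<open>Apply the operator with step size 1 to a plane wave and evaluate at the origin: the wave
  is 1 there, and its values at the shifts are the exponentials of the trigonometric
  polynomial.\<close>

lemma difference_symbol_waves:
  fixes a :: "('n::{finite,linorder} \<Rightarrow> nat) \<times> ('n \<Rightarrow> nat) \<Rightarrow> complex"
  obtains n :: nat and c p where "\<And>\<theta>. difference_symbol l l' a \<theta> = (\<Sum>i<n. c i * wave \<theta> (p i))"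
proof -
  obtain n c p where "\<And>u y. difference_op l l' a 1 u y = (\<Sum>i<n::nat. c i * u (y + p i))"
    using difference_op_translations[of 1 l l' a] by (metis zero_neq_one)
  from this[of "wave \<theta>" 0 for \<theta>] show ?thesis
    by (intro that) (simp add: difference_op_wave)
qed

text \<open>At the origin both operators reduce to their symbols; multiplication by \<epsilon>^l and
  homogeneity of \<open>diff_symbol\<close> move the estimate to the ray through \<eta>. The
  constant may depend on \<eta>.\<close>

lemma approximation_at_wave:
  fixes a :: "('n::{finite,linorder} \<Rightarrow> nat) \<times> ('n \<Rightarrow> nat) \<Rightarrow> complex"
  assumes "approximates_of_order M l l' a b"
  obtains C where "\<And>\<epsilon>. \<epsilon> > 0 \<Longrightarrow>
    norm (difference_symbol l l' a (\<epsilon> *\<^sub>R \<eta>) - diff_symbol l b (\<epsilon> *\<^sub>R \<eta>)) \<le> C * \<epsilon> ^ (l + M)"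
proof -
  obtain C where C: "\<And>\<epsilon>. \<epsilon> > 0 \<Longrightarrow>
     (SUP y. ereal (norm (difference_op l l' a \<epsilon> (wave \<eta>) y - diff_op l b (wave \<eta>) y))) \<le> ereal (C * \<epsilon> ^ M)"
    using assms smooth_bounded_wave[of \<eta>] unfolding approximates_of_order_def by blast
  show ?thesis
  proof (rule that)
    fix \<epsilon> :: real assume "\<epsilon> > 0"
    define X where "X = complex_of_real (1 / \<epsilon> ^ l) * difference_symbol l l' a (\<epsilon> *\<^sub>R \<eta>) - diff_symbol l b \<eta>"
    have "ereal (norm (difference_op l l' a \<epsilon> (wave \<eta>) 0 - diff_op l b (wave \<eta>) 0)) \<le> ereal (C * \<epsilon> ^ M)"
      by (rule order_trans[OF SUP_upper C[OF \<open>\<epsilon> > 0\<close>]]) simp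
    then have "norm X \<le> C * \<epsilon> ^ M"
      by (simp add: X_def difference_op_wave diff_op_wave)
    then have "\<epsilon> ^ l * norm X \<le> \<epsilon> ^ l * (C * \<epsilon> ^ M)"
      using \<open>\<epsilon> > 0\<close> by (intro mult_left_mono) auto
    also have "\<epsilon> ^ l * norm X = norm (complex_of_real (\<epsilon> ^ l) * X)"
      using \<open>\<epsilon> > 0\<close> by (simp add: norm_mult norm_power)
    also have "complex_of_real (\<epsilon> ^ l) * X =
        difference_symbol l l' a (\<epsilon> *\<^sub>R \<eta>) - diff_symbol l b (\<epsilon> *\<^sub>R \<eta>)"
      using \<open>\<epsilon> > 0\<close> by (simp add: X_def diff_symbol_scaleR algebra_simps)
    finally show "norm (difference_symbol l l' a (\<epsilon> *\<^sub>R \<eta>) - diff_symbol l b (\<epsilon> *\<^sub>R \<eta>)) \<le> C * \<epsilon> ^ (l + M)"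
      by (simp add: power_add mult_ac)
  qed
qed

text \<open>
  Restricted to a ray, the difference of the symbols is a polynomial of degree below \<open>l + M\<close> plus a
  remainder which is \<open>O(s\<^sup>l\<^sup>+\<^sup>M)\<close> uniformly in the direction; the approximation property, which is not
  uniform in the direction, forces the polynomial to vanish.
\<close>

lemma symbols_close:
  fixes a :: "('n::{finite,linorder} \<Rightarrow> nat) \<times> ('n \<Rightarrow> nat) \<Rightarrow> complex"
  assumes approx: "approximates_of_order M l l' a b" and "M > 0"
  obtains C where "C > 0"
    "\<And>\<theta>. norm (difference_symbol l l' a \<theta> - diff_symbol l b \<theta>) \<le> C * norm \<theta> ^ (l + M)"
proof -
  define N where "N = l + M"
  obtain n c p where waves: "\<And>\<theta>. difference_symbol l l' a \<theta> = (\<Sum>i<n::nat. c i * wave \<theta> (p i))"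
    using difference_symbol_waves[of l l' a] by blast
  \<comment> \<open>The sum bounds the Taylor remainders for all directions at once; the added 1
    makes it positive.\<close>
  define K where "K = (\<Sum>i<n. norm (c i) * norm (p i) ^ N) + 1"
  have "K > 0"
    unfolding K_def by (intro add_nonneg_pos sum_nonneg) auto
  have main: "norm (difference_symbol l l' a (s *\<^sub>R \<eta>) - diff_symbol l b (s *\<^sub>R \<eta>)) \<le> K * s ^ N"
    if "norm \<eta> \<le> 1" "s \<ge> 0" for \<eta> and s :: real
  proof -
    \<comment> \<open>Taylor coefficients of the difference along the ray: by homogeneity
      \<open>diff_symbol\<close> contributes in degree l alone, and l < N because M > 0.\<close>
    define q where "q k = (\<Sum>i<n. c i * ((\<i> * (p i \<bullet> \<eta>)) ^ k / fact k)) -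
      (if k = l then diff_symbol l b \<eta> else 0)" for k
    define g where "g s = difference_symbol l l' a (s *\<^sub>R \<eta>) - diff_symbol l b (s *\<^sub>R \<eta>)" for s
    have poly: "norm (g s - (\<Sum>k<N. q k * complex_of_real s ^ k)) \<le> K * s ^ N" if "s \<ge> 0" for s
    proof -
      have "(\<Sum>k<N. (if k = l then diff_symbol l b \<eta> else 0) * complex_of_real s ^ k) =
          (\<Sum>k<N. if k = l then diff_symbol l b \<eta> * complex_of_real s ^ k else 0)"
        by (intro sum.cong) auto
      then have "(\<Sum>k<N. (if k = l then diff_symbol l b \<eta> else 0) * complex_of_real s ^ k) =
          diff_symbol l b (s *\<^sub>R \<eta>)"
        using \<open>M > 0\<close> by (simp add: diff_symbol_scaleR N_def)
      moreover have "(\<Sum>k<N. (\<Sum>i<n. c i * ((\<i> * (p i \<bullet> \<eta>)) ^ k / fact k)) * complex_of_real s ^ k) =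
          (\<Sum>i<n. c i * (\<Sum>k<N. (\<i> * (p i \<bullet> \<eta>)) ^ k / fact k * complex_of_real s ^ k))"
        unfolding sum_distrib_left sum_distrib_right by (subst sum.swap) (simp add: mult_ac)
      ultimately have "g s - (\<Sum>k<N. q k * complex_of_real s ^ k) =
          (\<Sum>i<n. c i * (wave (s *\<^sub>R \<eta>) (p i) - (\<Sum>k<N. (\<i> * (p i \<bullet> \<eta>)) ^ k / fact k * complex_of_real s ^ k)))"
        by (simp add: g_def q_def waves left_diff_distrib right_diff_distrib sum_subtractf)
      also have "norm \<dots> \<le> (\<Sum>i<n. norm (c i) * (norm (p i) ^ N * \<bar>s\<bar> ^ N))"
        using \<open>norm \<eta> \<le> 1\<close> \<open>M > 0\<close>
        by (intro sum_norm_le, unfold norm_mult, intro mult_left_mono Taylor_wave) (auto simp: N_def)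
      also have "\<dots> \<le> K * s ^ N"
        using \<open>s \<ge> 0\<close> by (simp add: K_def sum_distrib_left distrib_left mult_ac)
      finally show ?thesis .
    qed
    obtain C where C: "\<And>s. s > 0 \<Longrightarrow> norm (g s) \<le> C * s ^ N"
      using approximation_at_wave[OF approx, of \<eta>] by (auto simp: g_def N_def)
    have "norm (\<Sum>k<N. q k * complex_of_real s ^ k) \<le> (C + K) * s ^ N" if "s > 0" for s
    proof -
      have "norm (\<Sum>k<N. q k * complex_of_real s ^ k) \<le>
          norm (g s) + norm (g s - (\<Sum>k<N. q k * complex_of_real s ^ k))"
        using norm_triangle_sub[of "\<Sum>k<N. q k * complex_of_real s ^ k" "g s"]
        by (simp add: norm_minus_commute)
      with C[OF that] poly[of s] that show ?thesis by (simp add: distrib_right)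
    qed
    \<comment> \<open>C depends on \<eta>, but it only serves to make the polynomial vanish; what
      remains is the uniform bound with K.\<close>
    from coeffs_zero_if_polynomial_small[OF this] have "(\<Sum>k<N. q k * complex_of_real s ^ k) = 0"
      by simp
    with poly[OF \<open>s \<ge> 0\<close>] show ?thesis by (simp add: g_def)
  qed
  show ?thesis
  proof (rule that[OF \<open>K > 0\<close>])
    fix \<theta> :: "real^'n::{finite,linorder}"
    \<comment> \<open>The direction \<open>sgn \<theta>\<close> is 0 at the origin, which the
      condition \<open>norm \<eta> \<le> 1\<close> admits.\<close>
    have "norm \<theta> *\<^sub>R sgn \<theta> = \<theta>" by (cases "\<theta> = 0") (simp_all add: sgn_div_norm)
    with main[of "sgn \<theta>" "norm \<theta>"]
    show "norm (difference_symbol l l' a \<theta> - diff_symbol l b \<theta>) \<le> K * norm \<theta> ^ (l + M)"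
      by (simp add: N_def norm_sgn)
  qed
qed

section \<open>Coercivity of the discrete symbol on the cube\<close>

abbreviation cube :: "real \<Rightarrow> (real^'n::finite) set" where
  "cube r \<equiv> cbox (\<chi> k. - r) (\<chi> k. r)"

lemma mem_cube: "\<theta> \<in> cube r \<longleftrightarrow> (\<forall>k. \<theta> $ k \<in> {- r..r})"
  by (simp add: mem_box_cart)

text \<open>Near the origin the remainder is at most half of the elliptic lower bound; on the
  compact rest of the cube, positivity yields a positive minimum. One constant is returned for both
  symbols, so that both exponentials later share their decay.\<close>

lemma difference_symbol_coercive:
  fixes a :: "('n::{finite,linorder} \<Rightarrow> nat) \<times> ('n \<Rightarrow> nat) \<Rightarrow> complex"
  assumes elliptic: "strongly_elliptic l b"
    and approx: "approximates_of_order M l l' a b" and "M > 0"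
    and pos: "\<And>\<theta>. (\<forall>k. \<theta> $ k \<in> {- pi..pi}) \<Longrightarrow> \<theta> \<noteq> 0 \<Longrightarrow> Re (difference_symbol l l' a \<theta>) > 0"
  obtains c where "c > 0" "\<And>\<theta>. \<theta> \<in> cube pi \<Longrightarrow> Re (difference_symbol l l' a \<theta>) \<ge> c * norm \<theta> ^ l"
    "\<And>\<theta>. Re (diff_symbol l b \<theta>) \<ge> c * norm \<theta> ^ l"
proof -
  obtain c0 where c0: "c0 > 0" "\<And>\<theta>. Re (diff_symbol l b \<theta>) \<ge> c0 * norm \<theta> ^ l"
    using elliptic unfolding strongly_elliptic_def by blast
  obtain C where C: "C > 0" 
    "\<And>\<theta>. norm (difference_symbol l l' a \<theta> - diff_symbol l b \<theta>) \<le> C * norm \<theta> ^ (l + M)"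
    using symbols_close[OF approx \<open>M > 0\<close>] by blast
  \<comment> \<open>The first entry gives |\<theta>|^M \<le> |\<theta>|, the second makes C
    |\<theta>| at most c0 / 2.\<close>
  define \<rho> where "\<rho> = min 1 (c0 / (2 * C))"
  have "\<rho> > 0" using c0 C by (simp add: \<rho>_def)
  have near: "Re (difference_symbol l l' a \<theta>) \<ge> c0 / 2 * norm \<theta> ^ l" if "norm \<theta> \<le> \<rho>" for \<theta>
  proof -
    have "norm \<theta> ^ M \<le> norm \<theta> ^ 1"
      using that \<open>M > 0\<close> by (intro power_decreasing) (auto simp: \<rho>_def)
    also have "\<dots> \<le> c0 / (2 * C)" using that by (simp add: \<rho>_def)
    finally have "C * norm \<theta> ^ M \<le> c0 / 2" using C(1) by (simp add: field_simps)
    then have "C * norm \<theta> ^ M * norm \<theta> ^ l \<le> c0 / 2 * norm \<theta> ^ l"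
      by (intro mult_right_mono) auto
    moreover have "Re (diff_symbol l b \<theta>) - Re (difference_symbol l l' a \<theta>) \<le> C * norm \<theta> ^ (l + M)"
      using C(2)[of \<theta>] abs_Re_le_cmod[of "difference_symbol l l' a \<theta> - diff_symbol l b \<theta>"] by simp
    ultimately show ?thesis using c0(2)[of \<theta>] by (simp add: power_add mult_ac)
  qed
  define S :: "(real^'n::{finite,linorder}) set" where "S = cube pi \<inter> {\<theta>. norm \<theta> \<ge> \<rho>}"
  have "compact S"
    unfolding S_def by (intro compact_Int_closed compact_cbox closed_Collect_le continuous_intros)
  obtain m where m: "m > 0" "\<And>\<theta>. \<theta> \<in> S \<Longrightarrow> Re (difference_symbol l l' a \<theta>) \<ge> m * norm \<theta> ^ l"
  proof (cases "S = {}")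
    case True
    then show ?thesis using that[of 1] by simp
  next
    case False
    have nz: "\<theta> \<noteq> 0" if "\<theta> \<in> S" for \<theta>
      using that \<open>\<rho> > 0\<close> by (auto simp: S_def)
    have "continuous_on S (\<lambda>\<theta>. Re (difference_symbol l l' a \<theta>) / norm \<theta> ^ l)"
      using nz by (intro continuous_intros) auto
    from continuous_attains_inf[OF \<open>compact S\<close> False this] obtain \<theta>0 where \<theta>0: "\<theta>0 \<in> S"
      "\<And>\<theta>. \<theta> \<in> S \<Longrightarrow> Re (difference_symbol l l' a \<theta>0) / norm \<theta>0 ^ l \<le> Re (difference_symbol l l' a \<theta>) / norm \<theta> ^ l"
      by blast
    show ?thesis
    proof (rule that)
      show "Re (difference_symbol l l' a \<theta>0) / norm \<theta>0 ^ l > 0"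
        using \<theta>0(1) nz[OF \<theta>0(1)] by (intro divide_pos_pos pos) (auto simp: S_def mem_cube)
      show "Re (difference_symbol l l' a \<theta>0) / norm \<theta>0 ^ l * norm \<theta> ^ l \<le> Re (difference_symbol l l' a \<theta>)"
        if "\<theta> \<in> S" for \<theta>
        using \<theta>0(2)[OF that] nz[OF that] by (simp add: pos_le_divide_eq)
    qed
  qed
  show ?thesis
  proof
    show "min (c0 / 2) m > 0" using c0 m by simp
    show "Re (diff_symbol l b \<theta>) \<ge> min (c0 / 2) m * norm \<theta> ^ l" for \<theta>
    proof -
      have "min (c0 / 2) m * norm \<theta> ^ l \<le> c0 * norm \<theta> ^ l"
        using c0 by (intro mult_right_mono) auto
      with c0(2)[of \<theta>] show ?thesis by linarith
    qed
    show "Re (difference_symbol l l' a \<theta>) \<ge> min (c0 / 2) m * norm \<theta> ^ l" if "\<theta> \<in> cube pi" for \<theta>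
    proof (cases "norm \<theta> \<le> \<rho>")
      case True
      have "min (c0 / 2) m * norm \<theta> ^ l \<le> c0 / 2 * norm \<theta> ^ l"
        by (intro mult_right_mono) auto
      with near[OF True] show ?thesis by linarith
    next
      case False
      have "min (c0 / 2) m * norm \<theta> ^ l \<le> m * norm \<theta> ^ l"
        by (intro mult_right_mono) auto
      with m(2)[of \<theta>] False that show ?thesis by (simp add: S_def)
    qed
  qed
qed

section \<open>Uniqueness for the difference equation\<close>

text \<open>
  The hypothesis \<open>step\<close> is the integrated form of a linear equation \<open>v' = L v\<close> with \<open>L\<close> bounded for the
  supremum norm over \<open>I\<close>. That norm is only assumed to be finite at every single time, so a Baire
  category argument is needed to make it locally bounded in time.
\<close>

lemma vanishing_if_pointwise_bounded:
  fixes v :: "'i \<Rightarrow> real \<Rightarrow> 'b::real_normed_vector"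
  assumes cont: "\<And>i. i \<in> I \<Longrightarrow> continuous_on {0..} (v i)"
    and fin: "\<And>t. t \<ge> 0 \<Longrightarrow> \<exists>K. \<forall>i\<in>I. norm (v i t) \<le> K"
    and "C > 0"
    and step: "\<And>i s t K. \<lbrakk>i \<in> I; 0 \<le> s; s \<le> t; \<forall>j\<in>I. \<forall>r\<in>{s..t}. norm (v j r) \<le> K\<rbrakk> \<Longrightarrow>
        norm (v i t - v i s) \<le> C * K * (t - s)"
    and init: "\<And>i. i \<in> I \<Longrightarrow> v i 0 = 0"
    and "i \<in> I" "t \<ge> 0"
  shows "v i t = 0"
proof -
  define bdd where "bdd K J \<longleftrightarrow> (\<forall>i\<in>I. \<forall>r\<in>J. norm (v i r) \<le> K)" for K and J :: "real set"
  \<comment> \<open>On an interval of length h the solution varies by at most C h = 1/2 times its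
    supremum.\<close>
  define h where "h = 1 / (2 * C)"
  have "h > 0" using \<open>C > 0\<close> by (simp add: h_def)

  \<comment> \<open>The supremum S over I and J satisfies S \<le> N + S/2, which gives S \<le> 2 N
    once S is finite. The bound K only supplies this finiteness and does not enter the
    result.\<close>
  have doubling: "bdd (2 * N) J"
    if J: "J \<subseteq> {0..}" "is_interval J" "\<And>r s. r \<in> J \<Longrightarrow> s \<in> J \<Longrightarrow> \<bar>r - s\<bar> \<le> h"
      and "bdd K J" "r0 \<in> J" and N: "\<forall>i\<in>I. norm (v i r0) \<le> N" for J K r0 N
  proof -
    define X where "X = (\<lambda>(i, r). norm (v i r)) ` (I \<times> J)"
    have "bdd_above X"
      using \<open>bdd K J\<close> by (auto simp: X_def bdd_def intro!: bdd_aboveI[of _ K])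
    then have up: "norm (v i r) \<le> Sup X" if "i \<in> I" "r \<in> J" for i r
      using that by (intro cSup_upper) (auto simp: X_def)
    have pos: "Sup X \<ge> 0"
      using up[OF \<open>i \<in> I\<close> \<open>r0 \<in> J\<close>] norm_ge_zero order_trans by blast
    have "norm (v i r) \<le> N + Sup X / 2" if "i \<in> I" "r \<in> J" for i r
    proof -
      have "norm (v i r - v i r0) \<le> C * Sup X * \<bar>r - r0\<bar>"
      proof (cases "r \<le> r0")
        case True
        have "{r..r0} \<subseteq> J"
          using J(2) that \<open>r0 \<in> J\<close> unfolding is_interval_1 by (meson atLeastAtMost_iff subsetI)
        then have "norm (v i r0 - v i r) \<le> C * Sup X * (r0 - r)"
          using True that J(1) up by (intro step) auto
        then show ?thesis using True by (simp add: norm_minus_commute)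
      next
        case False
        have "{r0..r} \<subseteq> J"
          using J(2) that \<open>r0 \<in> J\<close> unfolding is_interval_1 by (meson atLeastAtMost_iff subsetI)
        then have "norm (v i r - v i r0) \<le> C * Sup X * (r - r0)"
          using False that J(1) \<open>r0 \<in> J\<close> up by (intro step) auto
        then show ?thesis using False by simp
      qed
      also have "\<dots> \<le> C * Sup X * h"
        using J(3) that \<open>r0 \<in> J\<close> \<open>C > 0\<close> pos by (intro mult_left_mono) auto
      also have "\<dots> = Sup X / 2"
        using \<open>C > 0\<close> by (simp add: h_def)
      finally show ?thesis
        using bspec[OF N that(1)] norm_triangle_sub[of "v i r" "v i r0"] by linarith
    qed
    then have "Sup X \<le> N + Sup X / 2"
      using \<open>i \<in> I\<close> \<open>r0 \<in> J\<close> by (intro cSup_least) (auto simp: X_def)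
    then show ?thesis
      unfolding bdd_def by (auto dest: up)
  qed

  \<comment> \<open>These are the bad times, near which no bound uniform over I exists; the aim is
    to show that there are none.\<close>
  define F where "F = {t. t \<ge> 0 \<and> (\<forall>\<delta>>0. \<forall>K. \<not> bdd K (ball t \<delta> \<inter> {0..}))}"

  have "closed F"
  proof -
    have "open (- F)"
      unfolding open_dist
    proof safe
      fix t assume "t \<notin> F"
      then consider "t < 0" | \<delta> K where "\<delta> > 0" "bdd K (ball t \<delta> \<inter> {0..})"
        unfolding F_def mem_Collect_eq de_Morgan_conj not_le by blast
      then show "\<exists>e>0. \<forall>y. dist y t < e \<longrightarrow> y \<in> - F"
      proof cases
        case 1
        then show ?thesis by (intro exI[of _ "- t"]) (auto simp: F_def dist_real_def)
      next
        case (2 \<delta> K)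
        have "y \<in> - F" if "dist y t < \<delta> / 2" for y
        proof -
          have "ball y (\<delta> / 2) \<subseteq> ball t \<delta>"
            using that dist_triangle_half_r[of y t \<delta>] by (auto simp: subset_iff)
          then have "bdd K (ball y (\<delta> / 2) \<inter> {0..})"
            using 2(2) by (auto simp: bdd_def)
          moreover have "\<delta> / 2 > 0" using 2(1) by simp
          ultimately show ?thesis
            unfolding F_def by blast
        qed
        then show ?thesis using 2(1) by (intro exI[of _ "\<delta> / 2"]) simp
      qed
    qed
    then show ?thesis by (simp add: closed_def)
  qed

  have compact_bdd: "\<exists>K. bdd K J" if "compact J" "J \<subseteq> {0..}" "J \<inter> F = {}" for J
  proof -
    have "\<exists>\<delta> K. \<delta> > 0 \<and> bdd K (ball t \<delta> \<inter> {0..})" if "t \<in> J" for t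
      using that \<open>J \<subseteq> {0..}\<close> \<open>J \<inter> F = {}\<close> by (auto simp: F_def)
    then obtain \<delta> K where \<delta>: "\<And>t. t \<in> J \<Longrightarrow> \<delta> t > 0" "\<And>t. t \<in> J \<Longrightarrow> bdd (K t) (ball t (\<delta> t) \<inter> {0..})"
      by metis
    obtain D where D: "D \<subseteq> J" "finite D" "J \<subseteq> (\<Union>t\<in>D. ball t (\<delta> t))"
    proof (rule compactE_image[OF \<open>compact J\<close>, of J "\<lambda>t. ball t (\<delta> t)"])
      show "J \<subseteq> (\<Union>t\<in>J. ball t (\<delta> t))"
      proof
        fix x assume "x \<in> J"
        with \<delta>(1)[of x] show "x \<in> (\<Union>t\<in>J. ball t (\<delta> t))" by (intro UN_I[of x]) auto
      qed
    qed auto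
    have "norm (v i r) \<le> (\<Sum>t\<in>D. \<bar>K t\<bar>)" if ir: "i \<in> I" "r \<in> J" for i r
    proof -
      obtain t where t: "t \<in> D" "r \<in> ball t (\<delta> t)" using D(3) ir(2) by blast
      have "norm (v i r) \<le> \<bar>K t\<bar>"
      proof -
        have "r \<in> ball t (\<delta> t) \<inter> {0..}" "t \<in> J" using t D(1) ir \<open>J \<subseteq> {0..}\<close> by auto
        with \<delta>(2)[of t] ir(1) have "norm (v i r) \<le> K t" unfolding bdd_def by blast
        then show ?thesis by linarith
      qed
      also have "\<dots> \<le> (\<Sum>t\<in>D. \<bar>K t\<bar>)"
        using t(1) D(2) by (intro member_le_sum) auto
      finally show ?thesis .
    qed
    then show ?thesis unfolding bdd_def by blast
  qed

  have "F = {}"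
  proof (rule ccontr)
    assume "F \<noteq> {}"
    \<comment> \<open>These sets are relatively open in F by continuity and have empty intersection
      by finiteness at each time, so by Baire they are not all dense in F. Near a point p outside
      the closure of one of them, the bound n holds at all bad times.\<close>
    define G where "G n = {t \<in> F. \<exists>i\<in>I. norm (v i t) > real n}" for n
    have "openin (top_of_set F) (G n)" for n
    proof -
      have "openin (top_of_set F) (F \<inter> (\<lambda>t. norm (v i t)) -` {real n<..})" if "i \<in> I" for i
        using that by (intro continuous_openin_preimage_gen continuous_on_norm continuous_on_subset[OF cont])
          (auto simp: F_def)
      moreover have "G n = (\<Union>i\<in>I. F \<inter> (\<lambda>t. norm (v i t)) -` {real n<..})"
        by (auto simp: G_def)
      ultimately show ?thesis by (simp only:) (rule openin_Union, blast)
    qed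
    moreover have "(\<Inter>n. G n) = {}"
    proof -
      have False if "\<And>n. t \<in> G n" for t
      proof -
        have "t \<ge> 0" using that[of 0] by (simp add: G_def F_def)
        then obtain K where K: "\<And>i. i \<in> I \<Longrightarrow> norm (v i t) \<le> K" using fin by blast
        obtain n where "K \<le> real n" using real_arch_simple by blast
        with that[of n] K show False by (fastforce simp: G_def)
      qed
      then show ?thesis by blast
    qed
    ultimately obtain n where "\<not> F \<subseteq> closure (G n)"
      using Baire[OF \<open>closed F\<close>, of "range G"] \<open>F \<noteq> {}\<close> by auto
    then obtain p where p: "p \<in> F" "p \<notin> closure (G n)" by blast
    then obtain \<delta> where \<delta>: "\<delta> > 0" "\<And>t. t \<in> G n \<Longrightarrow> dist t p \<ge> \<delta>"
      unfolding closure_approachable by (auto simp: not_less)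
    have onF: "norm (v i t) \<le> real n" if "t \<in> F" "dist t p < \<delta>" "i \<in> I" for t i
    proof (rule ccontr)
      assume "\<not> norm (v i t) \<le> real n"
      then have "t \<in> G n" using that by (auto simp: G_def not_le)
      with \<delta>(2)[of t] that show False by simp
    qed
    have "norm (v i t) \<le> 2 * real n" if t: "t \<ge> 0" "dist t p < min \<delta> h" and "i \<in> I" for i t
    proof (cases "t \<in> F")
      case True
      with onF[of t i] that show ?thesis by simp
    next
      case False
      have p0: "p \<ge> 0" using p by (simp add: F_def)
      \<comment> \<open>For a good time t let s be the bad time closest to t between p and t: the
        bound n holds at s, and the rest of the segment from s to t is free of bad times.\<close>
      have "compact (closed_segment p t \<inter> F)"
        using \<open>closed F\<close> by (intro compact_Int_closed) auto
      then have "closed (closed_segment p t \<inter> F)" by (rule compact_imp_closed)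
      moreover have "closed_segment p t \<inter> F \<noteq> {}" using p(1) by auto
      ultimately obtain s where s': "s \<in> closed_segment p t \<inter> F"
        "\<forall>y\<in>closed_segment p t \<inter> F. dist t s \<le> dist t y"
        by (rule distance_attains_inf[of _ t]) (rule that, auto)
      then have s: "s \<in> closed_segment p t" "s \<in> F" by auto
      have "s \<noteq> t" using False s(2) by blast
      have gap: "r \<notin> F" if r: "r \<in> closed_segment s t" "r \<noteq> s" for r
      proof
        assume "r \<in> F"
        have "r \<in> closed_segment p t"
          using r(1) s(1) by (auto simp: closed_segment_eq_real_ivl split: if_splits)
        with s'(2) \<open>r \<in> F\<close> have "dist t s \<le> dist t r" by blast
        with r show False
          by (auto simp: closed_segment_eq_real_ivl dist_real_def split: if_splits)
      qed
      have pt: "\<bar>t - p\<bar> \<le> h" using t(2) by (simp add: dist_real_def)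
      have sub: "closed_segment s t \<subseteq> {0..}"
        using s(1) t(1) p0 by (auto simp: closed_segment_eq_real_ivl split: if_splits)
      have small: "\<bar>x - y\<bar> \<le> h" if "x \<in> closed_segment s t" "y \<in> closed_segment s t" for x y
        using that pt s(1) by (auto simp: closed_segment_eq_real_ivl split: if_splits)
      have sn: "norm (v i s) \<le> real n" if "i \<in> I" for i
        using s(1) t(2) by (intro onF s(2) that)
           (auto simp: closed_segment_eq_real_ivl dist_real_def split: if_splits)
      \<comment> \<open>N belongs to the single time t and is not controlled. Doubling from t on
        segments that stop short of s gives the bound 2 N up to s; this provides the finiteness for
        doubling from s, which replaces it by 2 n.\<close>
      obtain N where N: "\<forall>i\<in>I. norm (v i t) \<le> N" using fin t(1) by blast
      have "norm (v i r) \<le> max (2 * N) (real n)" if "i \<in> I" "r \<in> closed_segment s t" for i r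
      proof (cases "r = s")
        case True
        with sn[of i] that show ?thesis by simp
      next
        case False
        have sub': "closed_segment r t \<subseteq> closed_segment s t"
          using that by (simp add: subset_closed_segment)
        have "closed_segment r t \<inter> F = {}"
        proof -
          have "s \<notin> closed_segment r t"
            using that(2) False \<open>s \<noteq> t\<close> by (auto simp: closed_segment_eq_real_ivl split: if_splits)
          then show ?thesis using gap sub' by blast
        qed
        then obtain K where "bdd K (closed_segment r t)"
          using compact_bdd[of "closed_segment r t"] sub sub' by auto
        then have "bdd (2 * N) (closed_segment r t)"
          using sub sub' small[OF subsetD[OF sub'] subsetD[OF sub']] N
          by (intro doubling[of _ K t]) (auto simp: is_interval_convex_1)
        then show ?thesis using that(1) by (auto simp: bdd_def max.coboundedI1)
      qed
      then have "bdd (max (2 * N) (real n)) (closed_segment s t)"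
        by (simp add: bdd_def)
      then have "bdd (2 * real n) (closed_segment s t)"
        using sub small sn by (intro doubling[of _ "max (2 * N) (real n)" s]) (auto simp: is_interval_convex_1)
      then show ?thesis using \<open>i \<in> I\<close> by (simp add: bdd_def)
    qed
    then have "bdd (2 * real n) (ball p (min \<delta> h) \<inter> {0..})"
      by (auto simp: bdd_def dist_commute)
    moreover have "min \<delta> h > 0" using \<delta>(1) \<open>h > 0\<close> by simp
    ultimately show False using p(1) unfolding F_def by blast
  qed

  \<comment> \<open>Without bad times v is bounded on compact intervals, and doubling with the value
    0 at the left end propagates zero in steps of length h.\<close>
  have "bdd 0 {0..real n * h}" for n
  proof (induction n)
    case 0
    then show ?case by (simp add: bdd_def init)
  next
    case (Suc n)
    define J where "J = {real n * h..real (Suc n) * h}"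
    have "0 \<le> real n * h" using \<open>h > 0\<close> by simp
    then have J0: "J \<subseteq> {0..}" by (auto simp: J_def)
    obtain K where "bdd K J"
      using compact_bdd[of J] \<open>F = {}\<close> J0 by (auto simp: J_def)
    then have "bdd (2 * 0) J"
      using Suc.IH \<open>h > 0\<close> J0
      by (intro doubling[of J K "real n * h"]) (auto simp: J_def bdd_def is_interval_convex_1 algebra_simps)
    with Suc.IH show ?case
      unfolding bdd_def J_def by (metis atLeastAtMost_iff linear mult_zero_right)
  qed
  moreover obtain n where "t / h \<le> real n" using real_arch_simple by blast
  ultimately have "norm (v i t) \<le> 0"
    using \<open>h > 0\<close> \<open>t \<ge> 0\<close> \<open>i \<in> I\<close> unfolding bdd_def by (simp add: pos_divide_le_eq)
  then show ?thesis by simp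
qed

section \<open>Fourier integrals\<close>

text \<open>Fubini: \<open>lborel\<close> is the image of a product measure indexed by the basis
  vectors, and \<open>axis\<close> identifies coordinates with basis vectors.\<close>

lemma integral_prod_components:
  fixes f :: "'n::finite \<Rightarrow> real \<Rightarrow> 'b::{real_normed_field,banach,second_countable_topology}"
  assumes f: "\<And>k. integrable lborel (f k)"
  shows "integrable lborel (\<lambda>x::real^'n. \<Prod>k\<in>UNIV. f k (x $ k))" (is ?int)
    and "(\<integral>x. (\<Prod>k\<in>UNIV. f k ((x :: real^'n) $ k)) \<partial>lborel) = (\<Prod>k\<in>UNIV. \<integral>s. f k s \<partial>lborel)" (is ?eq)
proof -
  interpret product_sigma_finite "\<lambda>_::real^'n. lborel :: real measure"
    by (simp add: product_sigma_finite_def sigma_finite_lborel)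
  define e :: "'n \<Rightarrow> real^'n" where "e k = axis k 1" for k
  define F where "F v = f (inv e v)" for v
  have inj: "inj e" by (auto simp: inj_def e_def axis_eq_axis)
  have Basis: "Basis = e ` UNIV" by (auto simp: Basis_vec_def e_def)
  have F: "integrable lborel (F v)" for v by (simp add: F_def f)
  define T :: "(real^'n \<Rightarrow> real) \<Rightarrow> real^'n" where "T g = (\<Sum>v\<in>Basis. g v *\<^sub>R v)" for g
  have T: "T \<in> (\<Pi>\<^sub>M v\<in>Basis. lborel) \<rightarrow>\<^sub>M borel"
    unfolding T_def[abs_def] by measurable
  have lb: "lborel = distr (\<Pi>\<^sub>M v\<in>Basis. lborel) borel T"
    unfolding T_def[abs_def] by (rule lborel_eq)
  have meas: "(\<lambda>x::real^'n. \<Prod>k\<in>UNIV. f k (x $ k)) \<in> borel_measurable borel"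
  proof (intro borel_measurable_prod)
    fix k
    have "f k \<in> borel_measurable borel" using f[of k] by simp
    moreover have "(\<lambda>x::real^'n. x $ k) \<in> borel_measurable borel"
      by (intro borel_measurable_continuous_onI continuous_intros)
    ultimately show "(\<lambda>x::real^'n. f k (x $ k)) \<in> borel_measurable borel"
      using measurable_compose by blast
  qed
  have Tk: "T g $ k = g (e k)" for g k
  proof -
    have "T g $ k = T g \<bullet> e k" by (simp add: e_def inner_axis)
    also have "\<dots> = g (e k)"
      unfolding T_def using Basis by (subst inner_sum_left_Basis) auto
    finally show ?thesis .
  qed
  have prod_eq: "(\<Prod>v\<in>Basis. F v (g v)) = (\<Prod>k\<in>UNIV. f k (T g $ k))" for g
    unfolding Basis by (subst prod.reindex[OF inj]) (simp add: F_def inj Tk)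
  show ?int
    unfolding lb by (subst integrable_distr_eq[OF T meas])
      (simp add: prod_eq[symmetric] product_integrable_prod F)
  have "(\<integral>x. (\<Prod>k\<in>UNIV. f k ((x :: real^'n) $ k)) \<partial>lborel) =
      (\<integral>g. (\<Prod>v\<in>Basis. F v (g v)) \<partial>(\<Pi>\<^sub>M v\<in>Basis. lborel))"
    unfolding lb by (subst integral_distr[OF T meas]) (simp add: prod_eq)
  also have "\<dots> = (\<Prod>v\<in>Basis. \<integral>s. F v s \<partial>lborel)"
    by (rule product_integral_prod) (auto simp: F)
  also have "\<dots> = (\<Prod>k\<in>UNIV. \<integral>s. f k s \<partial>lborel)"
    unfolding Basis by (subst prod.reindex[OF inj]) (simp add: F_def inj)
  finally show ?eq .
qed

text \<open>For x \<noteq> 0 the interval contains a whole number of periods, so the antiderivative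
  agrees at both ends.\<close>

lemma integral_exp_symmetric_interval:
  assumes "r > 0" and "x * r / pi \<in> \<int>"
  shows "(\<integral>s. indicator {- r..r} s *\<^sub>R exp (\<i> * complex_of_real (x * s)) \<partial>lborel) = (if x = 0 then 2 * r else 0)"
proof (cases "x = 0")
  case True
  then show ?thesis using \<open>r > 0\<close> by (simp add: scaleR_conv_of_real)
next
  case False
  have "(\<integral>s. indicator {- r..r} s *\<^sub>R exp (\<i> * complex_of_real (x * s)) \<partial>lborel) =
      exp (\<i> * complex_of_real (x * r)) / (\<i> * x) - exp (\<i> * complex_of_real (x * - r)) / (\<i> * x)"
  proof (rule integral_FTC_Icc)
    show "((\<lambda>s. exp (\<i> * complex_of_real (x * s)) / (\<i> * x)) has_vector_derivative
        exp (\<i> * complex_of_real (x * s))) (at s within {- r..r})" for s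
    proof -
      have "((\<lambda>z. exp (\<i> * (x * z)) / (\<i> * x)) has_field_derivative exp (\<i> * (x * complex_of_real s))) (at s)"
        by (auto intro!: derivative_eq_intros simp: False algebra_simps)
      from has_vector_derivative_real_field[OF this] show ?thesis by simp
    qed
  qed (use \<open>r > 0\<close> in \<open>auto intro!: continuous_intros\<close>)
  also have "\<dots> = (cis (x * r) - cis (- (x * r))) / (\<i> * x)"
    by (simp add: cis_conv_exp diff_divide_distrib)
  also have "cis (x * r) - cis (- (x * r)) = 2 * \<i> * sin (x * r)"
    by (simp add: complex_eq_iff)
  also obtain k where "x * r = of_int k * pi"
    using assms(2) by (auto elim!: Ints_cases simp: field_simps)
  then have "sin (x * r) = 0"
    by (simp add: sin_zero_iff_int2)
  finally show ?thesis using False by simp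
qed

text \<open>Orthogonality of characters on the dual cell; it produces the discrete delta as the
  initial value of the Fourier integral.\<close>

lemma integral_wave_cube:
  fixes x :: "real^'n::finite"
  assumes "\<epsilon> > 0" and "x \<in> grid \<epsilon>"
  shows "(\<integral>\<eta>. indicator (cube (pi / \<epsilon>)) \<eta> *\<^sub>R wave \<eta> x \<partial>lborel) =
    (if x = 0 then complex_of_real ((2 * pi / \<epsilon>) ^ CARD('n)) else 0)"
proof -
  define r where "r = pi / \<epsilon>"
  have "r > 0" using assms by (simp add: r_def)
  define f where "f k s = indicator {- r..r} s *\<^sub>R exp (\<i> * complex_of_real (x $ k * s))" for k s
  have "x $ k * r / pi \<in> \<int>" for k
    using assms by (simp add: grid_def r_def)
  then have one: "(\<integral>s. f k s \<partial>lborel) = (if x $ k = 0 then 2 * complex_of_real r else 0)" for k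
    unfolding f_def by (subst integral_exp_symmetric_interval) (simp_all add: \<open>r > 0\<close>)
  have int: "integrable lborel (f k)" for k
    unfolding f_def[abs_def] set_integrable_def[symmetric]
    by (intro borel_integrable_atLeastAtMost' continuous_intros)
  have "indicator (cube r) \<eta> *\<^sub>R wave \<eta> x = (\<Prod>k\<in>UNIV. f k (\<eta> $ k))" for \<eta> :: "real^'n"
  proof -
    have "indicator (cube r) \<eta> = (\<Prod>k\<in>UNIV. indicator {- r..r} (\<eta> $ k) :: real)"
      by (auto simp: indicator_def mem_cube intro!: prod.neutral[symmetric])
    moreover have "wave \<eta> x = (\<Prod>k\<in>UNIV. exp (\<i> * complex_of_real (x $ k * \<eta> $ k)))"
      by (simp add: wave_def inner_vec_def sum_distrib_left exp_sum)
    ultimately show ?thesis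
      by (simp add: f_def scaleR_conv_of_real prod.distrib)
  qed
  then have "(\<integral>\<eta>. indicator (cube r) \<eta> *\<^sub>R wave \<eta> x \<partial>lborel) = (\<Prod>k\<in>UNIV. if x $ k = 0 then 2 * complex_of_real r else 0)"
    by (simp add: integral_prod_components(2) int one)
  also have "\<dots> = (if x = 0 then complex_of_real ((2 * r) ^ CARD('n)) else 0)"
    by (auto simp: vec_eq_iff)
  finally show ?thesis by (simp add: r_def)
qed

section \<open>Integrable envelopes and rescaling of the continuous kernel\<close>

lemma integrable_exp_minus_abs:
  assumes "c > 0"
  shows "integrable lborel (\<lambda>s::real. exp (- c * \<bar>s\<bar>))"
proof -
  have pos: "integrable lborel (\<lambda>s::real. indicator {0..} s *\<^sub>R exp (- c * s))"
  proof -
    have "set_integrable lebesgue {0..} (\<lambda>s::real. exp (- c * s))"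
      using assms by (intro nonnegative_absolutely_integrable_1 integrable_on_exp_minus_to_infinity) auto
    then show ?thesis
      unfolding set_integrable_def by (subst (asm) integrable_completion) auto
  qed
  from lborel_integrable_real_affine[OF this, of "-1" 0]
  have neg: "integrable lborel (\<lambda>s::real. indicator {..0} s *\<^sub>R exp (c * s))"
    by (simp add: indicator_def of_bool_def)
  show ?thesis
    by (rule Bochner_Integration.integrable_bound[OF Bochner_Integration.integrable_add[OF pos neg]])
       (auto simp: indicator_def abs_if)
qed

lemma power_times_exp_bounded:
  assumes "c > 0"
  obtains K where "K > 0" "\<And>r::real. r \<ge> 0 \<Longrightarrow> r ^ m * exp (- c * r) \<le> K"
proof (cases "m = 0")
  case True
  then show ?thesis using that[of 1] assms by simp
next
  case False
  \<comment> \<open>The value comes from (1 + y/m)^m \<le> exp y with y = c r; the division by m is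
    why m = 0 is treated apart.\<close>
  define K where "K = (real m / c) ^ m"
  have "r ^ m * exp (- c * r) \<le> K" if "r \<ge> 0" for r
  proof -
    have "(c * r / m) ^ m \<le> (1 + c * r / m) ^ m"
      using that assms by (intro power_mono) auto
    also have "\<dots> \<le> exp (c * r)"
      using that assms False order_trans[of "- real m" 0 "c * r"]
      by (intro exp_ge_one_plus_x_over_n_power_n) auto
    finally have "r ^ m * (c / m) ^ m \<le> exp (c * r)"
      by (simp add: power_mult_distrib power_divide mult_ac)
    then have "r ^ m \<le> exp (c * r) * K"
      using assms False by (simp add: K_def power_divide field_simps)
    then show ?thesis
      by (simp add: exp_minus field_simps)
  qed
  moreover have "K > 0" using assms False by (simp add: K_def)
  ultimately show ?thesis using that by blast
qed

text \<open>Domination by a product of one-dimensional exponentials: half of the rate absorbs the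
  power of the norm, the other half is shared equally among the coordinates, each at most the norm
  in modulus.\<close>

lemma integrable_power_norm_exp:
  assumes "c > 0" and "l > 0"
  shows "integrable lborel (\<lambda>\<eta>::real^'n::finite. norm \<eta> ^ m * exp (- c * norm \<eta> ^ l))"
proof -
  obtain K where K: "K > 0" "\<And>r::real. r \<ge> 0 \<Longrightarrow> r ^ m * exp (- (c / 2) * r) \<le> K"
    using power_times_exp_bounded[of "c / 2" m] assms by auto
  define a where "a = c / (2 * CARD('n))"
  have "a > 0" using assms by (simp add: a_def)
  have "integrable lborel (\<lambda>\<eta>::real^'n. \<Prod>k\<in>UNIV. exp (- a * \<bar>\<eta> $ k\<bar>))"
    by (intro integral_prod_components integrable_exp_minus_abs \<open>a > 0\<close>)
  then have "integrable lborel (\<lambda>\<eta>::real^'n. exp c * K * (\<Prod>k\<in>UNIV. exp (- a * \<bar>\<eta> $ k\<bar>)))"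
    by simp
  then show ?thesis
  proof (rule Bochner_Integration.integrable_bound)
    have "norm \<eta> ^ m * exp (- c * norm \<eta> ^ l) \<le> exp c * K * (\<Prod>k\<in>UNIV. exp (- a * \<bar>\<eta> $ k\<bar>))" for \<eta> :: "real^'n"
    proof -
      define r where "r = norm \<eta>"
      have "r \<ge> 0" by (simp add: r_def)
      \<comment> \<open>Replacing r^l by r - 1 covers r < 1 as well, at the price of the factor
        \<open>exp c\<close>.\<close>
      have "r - 1 \<le> r ^ l"
      proof (cases "r \<ge> 1")
        case True
        then have "r ^ 1 \<le> r ^ l" using assms by (intro power_increasing) auto
        then show ?thesis by simp
      next
        case False
        then show ?thesis using \<open>r \<ge> 0\<close> zero_le_power[of r l] by linarith
      qed
      then have "c * (r - 1) \<le> c * r ^ l" using assms by (intro mult_left_mono) auto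
      then have "exp (- c * r ^ l) \<le> exp (c - (c / 2) * r - (c / 2) * r)"
        by (simp add: algebra_simps)
      also have "\<dots> = exp c * exp (- (c / 2) * r) * exp (- (c / 2) * r)"
        unfolding exp_add[symmetric] by (simp add: algebra_simps)
      finally have "r ^ m * exp (- c * r ^ l) \<le> r ^ m * (exp c * exp (- (c / 2) * r) * exp (- (c / 2) * r))"
        using \<open>r \<ge> 0\<close> by (intro mult_left_mono) auto
      also have "\<dots> = exp c * (r ^ m * exp (- (c / 2) * r)) * exp (- (c / 2) * r)"
        by simp
      also have "\<dots> \<le> exp c * K * exp (- (c / 2) * r)"
        using K(2)[OF \<open>r \<ge> 0\<close>] by (intro mult_right_mono mult_left_mono) auto
      also have "\<dots> \<le> exp c * K * exp (- a * (\<Sum>k\<in>UNIV. \<bar>\<eta> $ k\<bar>))"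
      proof -
        have "(\<Sum>k\<in>UNIV. \<bar>\<eta> $ k\<bar>) \<le> (\<Sum>k\<in>(UNIV::'n set). r)"
          unfolding r_def by (intro sum_mono component_le_norm_cart)
        then have "a * (\<Sum>k\<in>UNIV. \<bar>\<eta> $ k\<bar>) \<le> a * (CARD('n) * r)"
          using \<open>a > 0\<close> by (intro mult_left_mono) auto
        also have "\<dots> = c / 2 * r" by (simp add: a_def)
        finally show ?thesis using K(1) by (intro mult_left_mono) auto
      qed
      finally show ?thesis
        by (simp add: r_def exp_sum sum_distrib_left sum_negf[symmetric] del: sum_negf)
    qed
    then show "AE \<eta> in lborel. norm (norm (\<eta> :: real^'n) ^ m * exp (- c * norm \<eta> ^ l)) \<le>
        norm (exp c * K * (\<Prod>k\<in>UNIV. exp (- a * \<bar>\<eta> $ k\<bar>)))"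
      using K(1) by (intro AE_I2) (simp add: abs_mult prod_nonneg)
  qed (auto intro!: borel_measurable_continuous_onI continuous_intros)
qed

lemma lborel_integral_scaleR:
  fixes f :: "'a::euclidean_space \<Rightarrow> 'b::{banach,second_countable_topology}"
  assumes "s > 0" and [measurable]: "f \<in> borel_measurable borel"
  shows "(\<integral>\<xi>. f \<xi> \<partial>lborel) = s ^ DIM('a) *\<^sub>R (\<integral>\<eta>. f (s *\<^sub>R \<eta>) \<partial>lborel)"
  using assms(1)
  by (subst lborel_affine[of s 0]) (auto simp: integral_density integral_distr)

text \<open>Substitution \<xi> = t^(1/l) \<eta>: homogeneity turns the symbol at \<xi> into t times
  the symbol at \<eta>, and the Jacobian t^(d/l) cancels the prefactor.\<close>

lemma H_kernel_scaled:
  fixes x :: "real^'n::finite"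
  assumes "t > 0" and "l > 0"
  shows "complex_of_real (1 / t powr (real CARD('n) / real l)) *
      H_kernel l b ((1 / t powr (1 / real l)) *\<^sub>R x) =
    complex_of_real (1 / (2 * pi) ^ CARD('n)) *
      (\<integral>\<eta>. exp (- (complex_of_real t * diff_symbol l b \<eta>)) * wave \<eta> x \<partial>lborel)"
proof -
  define s where "s = t powr (1 / real l)"
  have "s > 0" using assms by (simp add: s_def)
  have sl: "s ^ l = t" using assms by (simp add: s_def powr_power)
  have sn: "s ^ CARD('n) = t powr (real CARD('n) / real l)" using assms by (simp add: s_def powr_power)
  have "(\<integral>\<xi>. exp (- diff_symbol l b \<xi>) * wave \<xi> ((1 / s) *\<^sub>R x) \<partial>lborel) =
      s ^ CARD('n) *\<^sub>R (\<integral>\<eta>. exp (- diff_symbol l b (s *\<^sub>R \<eta>)) * wave (s *\<^sub>R \<eta>) ((1 / s) *\<^sub>R x) \<partial>lborel)"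
    using \<open>s > 0\<close> by (subst lborel_integral_scaleR[of s])
      (auto intro!: borel_measurable_continuous_onI continuous_intros)
  also have "\<dots> = s ^ CARD('n) *\<^sub>R (\<integral>\<eta>. exp (- (complex_of_real t * diff_symbol l b \<eta>)) * wave \<eta> x \<partial>lborel)"
    using \<open>s > 0\<close> by (simp add: diff_symbol_scaleR wave_def sl flip: of_real_power)
  finally show ?thesis
    unfolding H_kernel_def wave_def[symmetric] s_def[symmetric] sn[symmetric]
    using \<open>s > 0\<close> by (simp add: scaleR_conv_of_real)
qed

section \<open>The discrete Green function\<close>

text \<open>Bridge between the gauge integral, used for differentiation under the integral sign, and
  the Lebesgue integral, used for comparison with the kernel on the whole space.\<close>

lemma integral_cube_eq_lborel:
  fixes f :: "real^'n::finite \<Rightarrow> complex"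
  assumes "continuous_on (cube r) f"
  shows "integrable lborel (\<lambda>\<eta>. indicator (cube r) \<eta> *\<^sub>R f \<eta>)"
    and "integral (cube r) f = (\<integral>\<eta>. indicator (cube r) \<eta> *\<^sub>R f \<eta> \<partial>lborel)"
proof -
  show int: "integrable lborel (\<lambda>\<eta>. indicator (cube r) \<eta> *\<^sub>R f \<eta>)"
    by (intro borel_integrable_compact compact_cbox assms)
  show "integral (cube r) f = (\<integral>\<eta>. indicator (cube r) \<eta> *\<^sub>R f \<eta> \<partial>lborel)"
    using set_borel_integral_eq_integral(2)[of "cube r" f] int
    by (simp add: set_integrable_def set_lebesgue_integral_def)
qed

locale grid_scale =
  fixes l l' :: nat and a :: "('n::{finite,linorder} \<Rightarrow> nat) \<times> ('n \<Rightarrow> nat) \<Rightarrow> complex" and \<epsilon> :: real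
  assumes eps: "\<epsilon> > 0"
begin

definition op_symbol :: "real^'n::{finite,linorder} \<Rightarrow> complex" where
  "op_symbol \<eta> = complex_of_real (1 / \<epsilon> ^ l) * difference_symbol l l' a (\<epsilon> *\<^sub>R \<eta>)"

definition dual_cell :: "(real^'n::{finite,linorder}) set" where "dual_cell = cube (pi / \<epsilon>)"

definition green_integral :: "real^'n::{finite,linorder} \<Rightarrow> real \<Rightarrow> complex" where
  "green_integral x t = complex_of_real (1 / (2 * pi) ^ CARD('n)) *
     integral dual_cell (\<lambda>\<eta>. exp (- (complex_of_real t * op_symbol \<eta>)) * wave \<eta> x)"

lemma continuous_on_op_symbol [continuous_intros]:
  "continuous_on S f \<Longrightarrow> continuous_on S (\<lambda>x. op_symbol (f x))"
  unfolding op_symbol_def by (intro continuous_intros)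

lemma integrable_dual_cell: "continuous_on dual_cell f \<Longrightarrow> (f :: real^'n::{finite,linorder} \<Rightarrow> complex) integrable_on dual_cell"
  unfolding dual_cell_def by (rule integrable_continuous)

text \<open>The cell is compact, so differentiation under the integral is possible at every real t,
  including 0. It brings down the factor - \<open>op_symbol \<eta>\<close>, while the difference
  operator multiplies each wave by \<open>op_symbol \<eta>\<close>.\<close>

lemma green_integral_has_vector_derivative:
  "((\<lambda>t. green_integral x t) has_vector_derivative - difference_op l l' a \<epsilon> (\<lambda>z. green_integral z t) x) (at t)"
proof -
  obtain n c p where T: "\<And>u y. difference_op l l' a \<epsilon> u y = (\<Sum>i<n::nat. c i * u (y + p i))"
    using difference_op_translations[of \<epsilon> l l' a] eps by (metis less_irrefl)
  have waves: "(\<Sum>i<n. c i * wave \<eta> (x + p i)) = op_symbol \<eta> * wave \<eta> x" for \<eta>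
    using difference_op_wave[of l l' a \<epsilon> \<eta> x] by (simp add: T op_symbol_def)
  define k where "k = complex_of_real (1 / (2 * pi) ^ CARD('n))"
  have "((\<lambda>t. integral dual_cell (\<lambda>\<eta>. exp (- (complex_of_real t * op_symbol \<eta>)) * wave \<eta> x)) has_vector_derivative
      integral dual_cell (\<lambda>\<eta>. - (op_symbol \<eta> * exp (- (complex_of_real t * op_symbol \<eta>)) * wave \<eta> x))) (at t)"
    unfolding dual_cell_def
  proof (rule leibniz_rule_vector_derivative[where U = UNIV])
    fix t :: real and \<eta> :: "real^'n::{finite,linorder}"
    have "((\<lambda>z. exp (- (z * op_symbol \<eta>)) * wave \<eta> x) has_field_derivative
        - (op_symbol \<eta> * exp (- (complex_of_real t * op_symbol \<eta>)) * wave \<eta> x)) (at (complex_of_real t))"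
      by (auto intro!: derivative_eq_intros simp: algebra_simps)
    then show "((\<lambda>t. exp (- (complex_of_real t * op_symbol \<eta>)) * wave \<eta> x) has_vector_derivative
        - (op_symbol \<eta> * exp (- (complex_of_real t * op_symbol \<eta>)) * wave \<eta> x)) (at t within UNIV)"
      by (rule has_vector_derivative_real_field)
  next
    show "continuous_on (UNIV \<times> cube (pi / \<epsilon>))
        (\<lambda>(t, \<eta>). - (op_symbol \<eta> * exp (- (complex_of_real t * op_symbol \<eta>)) * wave \<eta> x))"
      unfolding case_prod_unfold by (intro continuous_intros)
  qed (auto intro!: integrable_continuous continuous_intros)
  from bounded_linear.has_vector_derivative[OF bounded_linear_mult_right this, of k]
  have "((\<lambda>t. green_integral x t) has_vector_derivative
      k * integral dual_cell (\<lambda>\<eta>. - (op_symbol \<eta> * exp (- (complex_of_real t * op_symbol \<eta>)) * wave \<eta> x))) (at t)"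
    by (simp add: green_integral_def[abs_def] k_def)
  moreover have "difference_op l l' a \<epsilon> (\<lambda>z. green_integral z t) x =
      k * integral dual_cell (\<lambda>\<eta>. op_symbol \<eta> * exp (- (complex_of_real t * op_symbol \<eta>)) * wave \<eta> x)"
  proof -
    have "difference_op l l' a \<epsilon> (\<lambda>z. green_integral z t) x =
        k * (\<Sum>i<n. integral dual_cell (\<lambda>\<eta>. c i * (exp (- (complex_of_real t * op_symbol \<eta>)) * wave \<eta> (x + p i))))"
      by (simp add: T green_integral_def k_def sum_distrib_left mult_ac)
    also have "(\<Sum>i<n. integral dual_cell (\<lambda>\<eta>. c i * (exp (- (complex_of_real t * op_symbol \<eta>)) * wave \<eta> (x + p i)))) =
        integral dual_cell (\<lambda>\<eta>. \<Sum>i<n. c i * (exp (- (complex_of_real t * op_symbol \<eta>)) * wave \<eta> (x + p i)))"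
      by (intro integral_sum[symmetric] integrable_dual_cell continuous_intros) auto
    also have "(\<lambda>\<eta>. \<Sum>i<n. c i * (exp (- (complex_of_real t * op_symbol \<eta>)) * wave \<eta> (x + p i))) =
        (\<lambda>\<eta>. op_symbol \<eta> * exp (- (complex_of_real t * op_symbol \<eta>)) * wave \<eta> x)"
    proof
      fix \<eta>
      have "(\<Sum>i<n. c i * (exp (- (complex_of_real t * op_symbol \<eta>)) * wave \<eta> (x + p i))) =
          exp (- (complex_of_real t * op_symbol \<eta>)) * (\<Sum>i<n. c i * wave \<eta> (x + p i))"
        by (simp add: sum_distrib_left mult_ac)
      then show "(\<Sum>i<n. c i * (exp (- (complex_of_real t * op_symbol \<eta>)) * wave \<eta> (x + p i))) =
          op_symbol \<eta> * exp (- (complex_of_real t * op_symbol \<eta>)) * wave \<eta> x"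
        by (simp add: waves)
    qed
    finally show ?thesis .
  qed
  ultimately show ?thesis by simp
qed

text \<open>The modulus of the integrand does not depend on x. This supplies the finiteness at each
  time that the uniqueness argument asks for.\<close>

lemma green_integral_bounded: "\<exists>K. \<forall>x. norm (green_integral x t) \<le> K"
proof -
  have "norm (integral dual_cell (\<lambda>\<eta>. exp (- (complex_of_real t * op_symbol \<eta>)) * wave \<eta> x)) \<le>
      integral dual_cell (\<lambda>\<eta>. norm (exp (- (complex_of_real t * op_symbol \<eta>))))" for x
    unfolding dual_cell_def
    by (intro integral_norm_bound_integral integrable_continuous continuous_intros)
       (auto simp: norm_mult)
  then have "norm (green_integral x t) \<le> norm (complex_of_real (1 / (2 * pi) ^ CARD('n))) *
      integral dual_cell (\<lambda>\<eta>. norm (exp (- (complex_of_real t * op_symbol \<eta>))))" for x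
    unfolding green_integral_def norm_mult by (intro mult_left_mono) auto
  then show ?thesis by blast
qed

lemma green_integral_initial:
  assumes "x \<in> grid \<epsilon>"
  shows "green_integral x 0 = (if x = 0 then complex_of_real (1 / \<epsilon> ^ CARD('n)) else 0)"
proof -
  have "integral dual_cell (\<lambda>\<eta>. wave \<eta> x) = (\<integral>\<eta>. indicator (cube (pi / \<epsilon>)) \<eta> *\<^sub>R wave \<eta> x \<partial>lborel)"
    unfolding dual_cell_def by (intro integral_cube_eq_lborel continuous_intros)
  then show ?thesis
    using eps by (simp add: green_integral_def integral_wave_cube[OF eps assms] power_divide)
qed

text \<open>The difference of the two functions vanishes initially and solves the same equation,
  whose operator is bounded in the supremum norm over the grid.\<close>

lemma green_function_eq:
  assumes green: "first_green_function l l' a \<epsilon> u" and "x \<in> grid \<epsilon>" "t \<ge> 0"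
  shows "u x t = green_integral x t"
proof -
  obtain n c p where p: "\<And>i. i < n \<Longrightarrow> p i \<in> grid \<epsilon>"
    and T: "\<And>u y. difference_op l l' a \<epsilon> u y = (\<Sum>i<n::nat. c i * u (y + p i))"
    using difference_op_translations[of \<epsilon> l l' a] eps by (metis less_irrefl)
  define C where "C = (\<Sum>i<n. norm (c i)) + 1"
  have "C > 0" unfolding C_def by (intro add_nonneg_pos sum_nonneg) auto
  have G_diff: "(\<lambda>t. green_integral y t) differentiable (at s within S)" for y s S
    using green_integral_has_vector_derivative has_vector_derivative_at_within differentiableI_vector by blast
  have u_diff: "u y differentiable (at s within {0..})" if "y \<in> grid \<epsilon>" "s \<ge> 0" for y s
    using green that by (auto simp: first_green_function_def)
  define v where "v y s = u y s - green_integral y s" for y s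
  have v_diff: "v y differentiable (at s within {0..})" if "y \<in> grid \<epsilon>" "s \<ge> 0" for y s
    unfolding v_def[abs_def] by (intro differentiable_diff u_diff G_diff that)
  then have v_cont: "continuous_on {0..} (v y)" if "y \<in> grid \<epsilon>" for y
    using that by (auto simp: differentiable_on_def intro!: differentiable_imp_continuous_on)
  have v_deriv: "(v y has_vector_derivative - (\<Sum>i<n. c i * v (y + p i) s)) (at s)"
    if "y \<in> grid \<epsilon>" "s > 0" for y s
  proof -
    have "u y differentiable (at s)"
      using u_diff[of y s] that at_within_interior[of s "{0..}"] by simp
    moreover have "vector_derivative (u y) (at s) + difference_op l l' a \<epsilon> (\<lambda>z. u z s) y = 0"
      using green that by (auto simp: first_green_function_def)
    ultimately have "(u y has_vector_derivative - difference_op l l' a \<epsilon> (\<lambda>z. u z s) y) (at s)"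
      by (metis add_eq_0_iff2 vector_derivative_works)
    from has_vector_derivative_diff[OF this green_integral_has_vector_derivative[of y s]]
    show ?thesis
      by (simp add: v_def[abs_def] T sum_subtractf right_diff_distrib)
  qed
  have "v x t = 0"
  proof (rule vanishing_if_pointwise_bounded[of "grid \<epsilon>" v C])
    show "\<exists>K. \<forall>y\<in>grid \<epsilon>. norm (v y s) \<le> K" if s: "s \<ge> 0" for s
    proof -
      \<comment> \<open>Exponent 0 in the decay condition is plain boundedness, the origin
        included.\<close>
      obtain K1 where K1: "\<And>y. y \<in> grid \<epsilon> \<Longrightarrow> norm y ^ 0 * norm (u y s) \<le> K1"
        using green s unfolding first_green_function_def by blast
      obtain K2 where K2: "\<And>y. norm (green_integral y s) \<le> K2" using green_integral_bounded by blast
      have "norm (v y s) \<le> K1 + K2" if "y \<in> grid \<epsilon>" for y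
        using K1[OF that] K2[of y] norm_triangle_ineq4[of "u y s" "green_integral y s"] by (simp add: v_def)
      then show ?thesis by blast
    qed
    show "norm (v y r - v y s) \<le> C * K * (r - s)"
      if y: "y \<in> grid \<epsilon>" and s: "0 \<le> s" "s \<le> r" and K: "\<forall>z\<in>grid \<epsilon>. \<forall>\<tau>\<in>{s..r}. norm (v z \<tau>) \<le> K" for y s r K
    proof (cases "s = r")
      case False
      then have "s < r" using s by simp
      \<comment> \<open>Mean value inequality for complex values; it takes derivatives only inside
        the interval, so s = 0 is allowed.\<close>
      have "\<exists>\<tau>\<in>{s<..<r}. norm (v y r - v y s) \<le> norm ((r - s) *\<^sub>R - (\<Sum>i<n. c i * v (y + p i) \<tau>))"
        by (intro mvt_general[of s r "v y" "\<lambda>\<tau> h. h *\<^sub>R - (\<Sum>i<n. c i * v (y + p i) \<tau>)"]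
            \<open>s < r\<close> continuous_on_subset[OF v_cont[OF y]])
          (use s v_deriv[OF y] in \<open>auto simp: has_vector_derivative_def\<close>)
      then obtain \<tau> where \<tau>: "\<tau> \<in> {s<..<r}"
        "norm (v y r - v y s) \<le> norm ((r - s) *\<^sub>R - (\<Sum>i<n. c i * v (y + p i) \<tau>))" by blast
      have "norm (\<Sum>i<n. c i * v (y + p i) \<tau>) \<le> (\<Sum>i<n. norm (c i) * K)"
      proof (intro sum_norm_le)
        fix i assume "i \<in> {..<n}"
        then have "y + p i \<in> grid \<epsilon>" using p y by (intro grid_add) auto
        then have "norm (v (y + p i) \<tau>) \<le> K" using K \<tau>(1) by auto
        then show "norm (c i * v (y + p i) \<tau>) \<le> norm (c i) * K"
          by (simp add: norm_mult mult_left_mono)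
      qed
      also have "\<dots> \<le> C * K"
      proof -
        have "K \<ge> 0" using K y \<tau>(1) norm_ge_zero[of "v y \<tau>"] by (meson atLeastAtMost_iff greaterThanLessThan_iff less_imp_le order_trans)
        then show ?thesis by (simp add: C_def distrib_right sum_distrib_right)
      qed
      finally have "(r - s) * norm (\<Sum>i<n. c i * v (y + p i) \<tau>) \<le> (r - s) * (C * K)"
        using \<open>s < r\<close> by (intro mult_left_mono) auto
      moreover have "norm ((r - s) *\<^sub>R - (\<Sum>i<n. c i * v (y + p i) \<tau>)) =
          (r - s) * norm (\<Sum>i<n. c i * v (y + p i) \<tau>)"
        using \<open>s < r\<close> by simp
      ultimately have "norm (v y r - v y s) \<le> (r - s) * (C * K)" using \<tau>(2) by linarith
      then show ?thesis by (simp only: mult_ac)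
    qed simp
    show "v y 0 = 0" if "y \<in> grid \<epsilon>" for y
      using green that by (simp add: v_def green_integral_initial first_green_function_def)
  qed (use assms v_cont \<open>C > 0\<close> in auto)
  then show ?thesis by (simp add: v_def)
qed

end

section \<open>Comparison of the discrete and the continuous kernel\<close>

text \<open>Mean value inequality on the half-plane of real part at most m: it is convex, and
  \<open>exp\<close> has derivative of modulus at most \<open>exp m\<close> there.\<close>

lemma norm_exp_diff_le:
  fixes z w :: complex
  assumes "Re z \<le> m" "Re w \<le> m"
  shows "norm (exp z - exp w) \<le> exp m * norm (z - w)"
proof -
  have "convex {z. Re z \<le> m}" by (rule convex_halfspace_Re_le)
  then show ?thesis
    by (rule field_differentiable_bound[where f' = exp])
       (use assms in \<open>auto intro!: derivative_eq_intros\<close>)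
qed

theorem corollary3p2:
  fixes l l' M :: nat
    and b :: "('n::{finite,linorder} \<Rightarrow> nat) \<Rightarrow> complex"
    and a :: "('n \<Rightarrow> nat) \<times> ('n \<Rightarrow> nat) \<Rightarrow> complex"
    and u :: "real \<Rightarrow> real^'n::{finite,linorder} \<Rightarrow> real \<Rightarrow> complex"
    and t1 :: real
  assumes "even l" and "l > 0" and "l \<le> l'" and "M > 0"
    and elliptic: "strongly_elliptic l b"
    and approx: "approximates_of_order M l l' a b"
    and symbol_pos: "\<And>\<theta>. (\<forall>k. \<theta> $ k \<in> {- pi..pi}) \<Longrightarrow> \<theta> \<noteq> 0 \<Longrightarrow> Re (difference_symbol l l' a \<theta>) > 0"
    and green: "\<And>\<epsilon>. \<epsilon> > 0 \<Longrightarrow> first_green_function l l' a \<epsilon> (u \<epsilon>)"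
    and "t1 > 0"
  shows "\<exists>C>0. \<forall>\<^sub>F \<epsilon> in at_right 0.
           (SUP t\<in>{t1..}. SUP x\<in>grid \<epsilon>.
              ereal (norm (u \<epsilon> x t -
                complex_of_real (1 / t powr (real CARD('n) / real l)) *
                H_kernel l b ((1 / t powr (1 / real l)) *\<^sub>R x))))
           \<le> ereal (C * \<epsilon> ^ M)"
proof -
  obtain c where c: "c > 0" 
    "\<And>\<theta>. \<theta> \<in> cube pi \<Longrightarrow> Re (difference_symbol l l' a \<theta>) \<ge> c * norm \<theta> ^ l"
    "\<And>\<theta>. Re (diff_symbol l b \<theta>) \<ge> c * norm \<theta> ^ l"
    using difference_symbol_coercive[OF elliptic approx \<open>M > 0\<close> symbol_pos] by blast
  obtain C where C: "C > 0" 
    "\<And>\<theta>. norm (difference_symbol l l' a \<theta> - diff_symbol l b \<theta>) \<le> C * norm \<theta> ^ (l + M)"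
    using symbols_close[OF approx \<open>M > 0\<close>] by blast
  \<comment> \<open>The envelope, free of \<epsilon>, t and x. Its rate \<open>t1 * c / 2\<close> is
    the half left over at the earliest time after the factor t |\<eta>|^l has been absorbed.\<close>
  define g where "g \<eta> = norm \<eta> ^ M * exp (- (t1 * c / 2) * norm \<eta> ^ l)" for \<eta> :: "real^'n::{finite,linorder}"
  have int_g: "integrable lborel g"
    unfolding g_def[abs_def] using \<open>t1 > 0\<close> c(1) \<open>l > 0\<close> by (intro integrable_power_norm_exp) auto
  have g_nonneg: "g \<eta> \<ge> 0" for \<eta> by (simp add: g_def)
  \<comment> \<open>The first term serves frequencies inside the dual cell, the second those
    outside.\<close>
  define K where "K = 2 * C / c + 1 / pi ^ M"
  have "K > 0" using C(1) c(1) by (simp add: K_def add_pos_pos)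
  define k where "k = 1 / (2 * pi) ^ CARD('n)"
  have "k > 0" by (simp add: k_def)
  define D where "D = k * (K * (\<integral>\<eta>. g \<eta> \<partial>lborel)) + 1"
  have "D > 0"
    using \<open>k > 0\<close> \<open>K > 0\<close> g_nonneg unfolding D_def by (intro add_nonneg_pos mult_nonneg_nonneg) auto

  have main: "norm (u \<epsilon> x t - complex_of_real (1 / t powr (real CARD('n) / real l)) *
        H_kernel l b ((1 / t powr (1 / real l)) *\<^sub>R x)) \<le> D * \<epsilon> ^ M"
    if "\<epsilon> > 0" "t \<ge> t1" "x \<in> grid \<epsilon>" for \<epsilon> t x
  proof -
    interpret grid_scale l l' a \<epsilon> by unfold_locales (rule that)
    have "t > 0" using that \<open>t1 > 0\<close> by linarith
    define A where "A = diff_symbol l b"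
    have contA: "continuous_on S f \<Longrightarrow> continuous_on S (\<lambda>x. A (f x))" for S f
      unfolding A_def by (intro continuous_intros)
    \<comment> \<open>\<open>P\<close> is the integrand of the discrete kernel cut off to the cell,
      \<open>R\<close> that of the rescaled \<open>H_kernel\<close> on the whole space.\<close>
    define P where "P \<eta> = indicator dual_cell \<eta> *\<^sub>R (exp (- (complex_of_real t * op_symbol \<eta>)) * wave \<eta> x)" for \<eta>
    define R where "R \<eta> = exp (- (complex_of_real t * A \<eta>)) * wave \<eta> x" for \<eta>
    have decay: "exp (- (t * (c * norm \<eta> ^ l))) \<le> exp (- (t1 * c / 2) * norm \<eta> ^ l)" for \<eta> :: "real^'n::{finite,linorder}"
    proof -
      have "t1 * (c * norm \<eta> ^ l) \<le> t * (c * norm \<eta> ^ l)"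
        using \<open>t \<ge> t1\<close> c(1) by (intro mult_right_mono) auto
      moreover have "0 \<le> t1 * (c * norm \<eta> ^ l)" using \<open>t1 > 0\<close> c(1) by simp
      ultimately show ?thesis by (simp add: algebra_simps)
    qed
    have normR: "norm (R \<eta>) \<le> exp (- (t * (c * norm \<eta> ^ l)))" for \<eta>
    proof -
      have "t * (c * norm \<eta> ^ l) \<le> t * Re (A \<eta>)"
        using \<open>t > 0\<close> c(3)[of \<eta>] by (intro mult_left_mono) (auto simp: A_def)
      then show ?thesis by (simp add: R_def norm_mult)
    qed
    have est: "norm (P \<eta> - R \<eta>) \<le> K * \<epsilon> ^ M * g \<eta>" for \<eta>
    proof (cases "\<eta> \<in> dual_cell")
      case True
      define r where "r = norm \<eta>"
      have "r \<ge> 0" by (simp add: r_def)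
      have scale: "complex_of_real (\<epsilon> ^ l) * op_symbol \<eta> = difference_symbol l l' a (\<epsilon> *\<^sub>R \<eta>)"
        "complex_of_real (\<epsilon> ^ l) * A \<eta> = diff_symbol l b (\<epsilon> *\<^sub>R \<eta>)"
        using \<open>\<epsilon> > 0\<close> by (simp_all add: op_symbol_def A_def diff_symbol_scaleR)
      have cube: "\<epsilon> *\<^sub>R \<eta> \<in> cube pi"
        using True \<open>\<epsilon> > 0\<close> by (auto simp: dual_cell_def mem_cube field_simps)
      have "\<epsilon> ^ l * Re (op_symbol \<eta>) = Re (difference_symbol l l' a (\<epsilon> *\<^sub>R \<eta>))"
        using arg_cong[OF scale(1), of Re] by simp
      also have "\<dots> \<ge> \<epsilon> ^ l * (c * r ^ l)"
        using c(2)[OF cube] \<open>\<epsilon> > 0\<close> by (simp add: r_def power_mult_distrib mult_ac)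
      finally have Re_op_symbol: "Re (op_symbol \<eta>) \<ge> c * r ^ l" using \<open>\<epsilon> > 0\<close> by simp
      have "\<epsilon> ^ l * norm (op_symbol \<eta> - A \<eta>) = norm (complex_of_real (\<epsilon> ^ l) * (op_symbol \<eta> - A \<eta>))"
        using \<open>\<epsilon> > 0\<close> by (simp add: norm_mult norm_power)
      also have "\<dots> = norm (difference_symbol l l' a (\<epsilon> *\<^sub>R \<eta>) - diff_symbol l b (\<epsilon> *\<^sub>R \<eta>))"
        by (simp only: right_diff_distrib scale)
      also have "\<dots> \<le> \<epsilon> ^ l * (C * \<epsilon> ^ M * r ^ (l + M))"
        using C(2)[of "\<epsilon> *\<^sub>R \<eta>"] \<open>\<epsilon> > 0\<close> by (simp add: r_def power_mult_distrib power_add mult_ac)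
      finally have BA: "norm (op_symbol \<eta> - A \<eta>) \<le> C * \<epsilon> ^ M * r ^ (l + M)" using \<open>\<epsilon> > 0\<close> by simp
      have "P \<eta> - R \<eta> = (exp (- (complex_of_real t * op_symbol \<eta>)) - exp (- (complex_of_real t * A \<eta>))) * wave \<eta> x"
        using True by (simp add: P_def R_def left_diff_distrib)
      then have "norm (P \<eta> - R \<eta>) = norm (exp (- (complex_of_real t * op_symbol \<eta>)) - exp (- (complex_of_real t * A \<eta>)))"
        by (simp add: norm_mult)
      also have "\<dots> \<le> exp (- (t * (c * r ^ l))) *
          norm (- (complex_of_real t * op_symbol \<eta>) - - (complex_of_real t * A \<eta>))"
        using \<open>t > 0\<close> Re_op_symbol c(3)[of \<eta>] by (intro norm_exp_diff_le) (auto simp: r_def A_def)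
      also have "norm (- (complex_of_real t * op_symbol \<eta>) - - (complex_of_real t * A \<eta>)) = t * norm (op_symbol \<eta> - A \<eta>)"
      proof -
        have "- (complex_of_real t * op_symbol \<eta>) - - (complex_of_real t * A \<eta>) = - (complex_of_real t * (op_symbol \<eta> - A \<eta>))"
          by (simp add: algebra_simps)
        then show ?thesis using \<open>t > 0\<close> by (simp only: norm_minus_cancel norm_mult norm_of_real)
      qed
      also have "exp (- (t * (c * r ^ l))) * (t * norm (op_symbol \<eta> - A \<eta>)) \<le>
          exp (- (t * (c * r ^ l))) * (t * (C * \<epsilon> ^ M * r ^ (l + M)))"
        using BA \<open>t > 0\<close> by (intro mult_left_mono) auto
      \<comment> \<open>With y = t c r^l / 2 the factor t r^l becomes 2 y / c, the origin of the
        constant 2 C / c. Then y exp(-y) \<le> 1 removes one factor, and the remaining exp(-y) is at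
        most its value at \<open>t1\<close>.\<close>
      also have "\<dots> = 2 * C / c * \<epsilon> ^ M * r ^ M * ((t * (c * r ^ l) / 2) * exp (- (t * (c * r ^ l) / 2)) * exp (- (t * (c * r ^ l) / 2)))"
      proof -
        have "exp (- (t * (c * r ^ l))) = exp (- (t * (c * r ^ l) / 2)) * exp (- (t * (c * r ^ l) / 2))"
          by (simp flip: exp_add)
        then show ?thesis using c(1) by (simp add: power_add field_simps)
      qed
      also have "\<dots> \<le> 2 * C / c * \<epsilon> ^ M * r ^ M * (1 * exp (- (t1 * c / 2) * r ^ l))"
      proof -
        define y where "y = t * (c * r ^ l) / 2"
        have "y \<ge> 0" using \<open>t > 0\<close> c(1) \<open>r \<ge> 0\<close> by (simp add: y_def)
        have "y \<le> exp y" using exp_ge_add_one_self[of y] by linarith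
        then have "y * exp (- y) \<le> 1" by (simp add: exp_minus field_simps)
        moreover have "exp (- y) \<le> exp (- (t1 * c / 2) * r ^ l)"
          using mult_right_mono[OF \<open>t \<ge> t1\<close>, of "c * r ^ l"] c(1) \<open>r \<ge> 0\<close> by (simp add: y_def algebra_simps)
        ultimately have "y * exp (- y) * exp (- y) \<le> 1 * exp (- (t1 * c / 2) * r ^ l)"
          using \<open>y \<ge> 0\<close> by (intro mult_mono) auto
        then show ?thesis
          unfolding y_def[symmetric] using C(1) c(1) \<open>\<epsilon> > 0\<close> \<open>r \<ge> 0\<close> by (intro mult_left_mono) auto
      qed
      also have "\<dots> = 2 * C / c * (\<epsilon> ^ M * g \<eta>)"
        by (simp add: g_def r_def)
      also have "\<dots> \<le> K * (\<epsilon> ^ M * g \<eta>)"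
        using \<open>\<epsilon> > 0\<close> g_nonneg[of \<eta>] by (intro mult_right_mono) (auto simp: K_def)
      finally show ?thesis by (simp add: mult.assoc)
    next
      case False
      \<comment> \<open>Outside the cell \<epsilon> |\<eta>| / \<pi> is at least 1, so its M-th
        power can be inserted as a factor; this creates \<epsilon>^M from the exponential
        tail.\<close>
      then obtain j where "\<not> \<eta> $ j \<in> {- (pi / \<epsilon>)..pi / \<epsilon>}" by (auto simp: dual_cell_def mem_cube)
      then have "pi / \<epsilon> \<le> \<bar>\<eta> $ j\<bar>" by auto
      also have "\<dots> \<le> norm \<eta>" by (rule component_le_norm_cart)
      finally have "1 \<le> \<epsilon> * norm \<eta> / pi" using \<open>\<epsilon> > 0\<close> by (simp add: field_simps)
      then have "1 \<le> (\<epsilon> * norm \<eta> / pi) ^ M" by (rule one_le_power)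
      have "norm (P \<eta> - R \<eta>) = norm (R \<eta>)" using False by (simp add: P_def)
      also have "\<dots> \<le> exp (- (t1 * c / 2) * norm \<eta> ^ l)"
        using normR decay order_trans by blast
      also have "\<dots> \<le> (\<epsilon> * norm \<eta> / pi) ^ M * exp (- (t1 * c / 2) * norm \<eta> ^ l)"
        using mult_right_mono[OF \<open>1 \<le> (\<epsilon> * norm \<eta> / pi) ^ M\<close>] by fastforce
      also have "\<dots> = 1 / pi ^ M * (\<epsilon> ^ M * g \<eta>)"
        by (simp add: g_def power_mult_distrib power_divide)
      also have "\<dots> \<le> K * (\<epsilon> ^ M * g \<eta>)"
        using \<open>\<epsilon> > 0\<close> g_nonneg[of \<eta>] C(1) c(1) by (intro mult_right_mono) (auto simp: K_def)
      finally show ?thesis by (simp add: mult.assoc)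
    qed
    have contP: "continuous_on S (\<lambda>\<eta>. exp (- (complex_of_real t * op_symbol \<eta>)) * wave \<eta> x)" for S
      by (intro continuous_intros)
    have intP: "integrable lborel P"
      unfolding P_def[abs_def] dual_cell_def by (intro integral_cube_eq_lborel contP)
    have measR: "R \<in> borel_measurable borel"
      unfolding R_def[abs_def] by (intro borel_measurable_continuous_onI continuous_intros contA)
    have int_bound: "integrable lborel (\<lambda>\<eta>. K * \<epsilon> ^ M * g \<eta>)" using int_g by simp
    have intPR: "integrable lborel (\<lambda>\<eta>. P \<eta> - R \<eta>)"
    proof (rule Bochner_Integration.integrable_bound[OF int_bound])
      show "(\<lambda>\<eta>. P \<eta> - R \<eta>) \<in> borel_measurable lborel"
        using intP measR by simp
      show "AE \<eta> in lborel. norm (P \<eta> - R \<eta>) \<le> norm (K * \<epsilon> ^ M * g \<eta>)"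
        using est \<open>K > 0\<close> \<open>\<epsilon> > 0\<close> g_nonneg by (intro AE_I2) (simp add: abs_mult)
    qed
    \<comment> \<open>Integrability of \<open>R\<close> is inherited from \<open>P\<close> and the
      dominated difference.\<close>
    then have intR: "integrable lborel R"
      using Bochner_Integration.integrable_diff[OF intP intPR] by simp
    have "u \<epsilon> x t = green_integral x t"
      using green[OF \<open>\<epsilon> > 0\<close>] \<open>t > 0\<close> that by (intro green_function_eq) auto
    also have "\<dots> = complex_of_real k * (\<integral>\<eta>. P \<eta> \<partial>lborel)"
      unfolding green_integral_def k_def P_def dual_cell_def by (subst integral_cube_eq_lborel(2)[OF contP]) simp
    finally have "u \<epsilon> x t - complex_of_real (1 / t powr (real CARD('n) / real l)) *
        H_kernel l b ((1 / t powr (1 / real l)) *\<^sub>R x) =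
        complex_of_real k * ((\<integral>\<eta>. P \<eta> \<partial>lborel) - (\<integral>\<eta>. R \<eta> \<partial>lborel))"
      using H_kernel_scaled[OF \<open>t > 0\<close> \<open>l > 0\<close>, of b x] by (simp add: k_def R_def A_def right_diff_distrib)
    also have "\<dots> = complex_of_real k * (\<integral>\<eta>. P \<eta> - R \<eta> \<partial>lborel)"
      using intP intR by simp
    finally have "norm (u \<epsilon> x t - complex_of_real (1 / t powr (real CARD('n) / real l)) *
        H_kernel l b ((1 / t powr (1 / real l)) *\<^sub>R x)) = k * norm (\<integral>\<eta>. P \<eta> - R \<eta> \<partial>lborel)"
      using \<open>k > 0\<close> by (simp add: norm_mult)
    also have "\<dots> \<le> k * (\<integral>\<eta>. norm (P \<eta> - R \<eta>) \<partial>lborel)"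
      using \<open>k > 0\<close> by (intro mult_left_mono integral_norm_bound) auto
    also have "\<dots> \<le> k * (\<integral>\<eta>. K * \<epsilon> ^ M * g \<eta> \<partial>lborel)"
      using \<open>k > 0\<close> est by (intro mult_left_mono integral_mono integrable_norm intPR int_bound) auto
    also have "\<dots> \<le> D * \<epsilon> ^ M"
      using \<open>\<epsilon> > 0\<close> by (simp add: D_def distrib_right mult_ac)
    finally show ?thesis .
  qed
  have "(SUP t\<in>{t1..}. SUP x\<in>grid \<epsilon>.
              ereal (norm (u \<epsilon> x t -
                complex_of_real (1 / t powr (real CARD('n) / real l)) *
                H_kernel l b ((1 / t powr (1 / real l)) *\<^sub>R x))))
           \<le> ereal (D * \<epsilon> ^ M)" if "\<epsilon> > 0" for \<epsilon>
    using main[OF that] by (intro SUP_least) auto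
  then show ?thesis
    using \<open>D > 0\<close> by (intro exI[of _ D]) (auto simp: eventually_at_filter)
qed

end
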